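(* If there exists an algorithm which decides whether a given digraph on $n$ vertices whose underlying undirected graph has treedepth $\mathrm{td}$ is $2$-colorable in time $\mathrm{td}^{o(\mathrm{td})}n^{O(1)}$, then the Exponential Time Hypothesis is false.
   Context: A digraph is $2$-colorable if its vertices can be colored with $2$ colors so that each color class induces an acyclic subdigraph. Treedepth of an undirected graph $G$: $G$ has treedepth at most $k$ if (i) $G$ has at most $k$ vertices, or (ii) $G$ is disconnected and all its components have treedepth at most $k$, or (iii) there is a vertex $u$ such that $G-u$ has treedepth at most $k-1$. The Exponential Time Hypothesis is used in the form: \textsc{3-SAT} with $n$ variables and $m$ clauses cannot be solved in time $2^{o(n+m)}$. *)

theory Defs
  imports "Graph_Theory.Digraph_Component" "HOL-Library.Landau_Symbols"
begin

section \<open>Digraph coloring and treedepth\<close>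

text \<open>
  Cycles are the closed directed walks of the library without repeated vertices; in
  particular, a pair of opposite arcs is a cycle. The library constant \<^const>\<open>forest\<close>
  is the same predicate under a name that suggests undirected graphs.
\<close>

definition acyclic_digraph :: "('a, 'b) pre_digraph \<Rightarrow> bool" where
  "acyclic_digraph G \<longleftrightarrow> \<not> (\<exists>p. pre_digraph.cycle G p)"

definition colorable :: "nat \<Rightarrow> ('a, 'b) pre_digraph \<Rightarrow> bool" where
  "colorable k G \<longleftrightarrow> (\<exists>c :: 'a \<Rightarrow> nat. (\<forall>v \<in> verts G. c v < k) \<and>
     (\<forall>i < k. acyclic_digraph (G \<restriction> {v \<in> verts G. c v = i})))"

text \<open>
  Undirected graphs are symmetric digraphs. The strongly connected components of a symmetric
  digraph are exactly its connected components.
\<close>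

inductive treedepth_le :: "('a, 'b) pre_digraph \<Rightarrow> nat \<Rightarrow> bool" where
  few_vertices: "finite (verts G) \<Longrightarrow> card (verts G) \<le> k \<Longrightarrow> treedepth_le G k"
| disconnected: "\<not> connected G \<Longrightarrow> (\<And>H. H \<in> pre_digraph.sccs G \<Longrightarrow> treedepth_le H k) \<Longrightarrow>
    treedepth_le G k"
| delete_vertex: "u \<in> verts G \<Longrightarrow> treedepth_le (pre_digraph.del_vert G u) k \<Longrightarrow>
    treedepth_le G (Suc k)"

text \<open>Treedepth of the underlying undirected graph of a digraph.\<close>

definition underlying_treedepth :: "('a, 'b) pre_digraph \<Rightarrow> nat" where
  "underlying_treedepth G = (LEAST k. treedepth_le (with_proj (mk_symmetric G)) k)"

lemma treedepth_le_underlying_treedepth: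
  assumes "finite (verts G)"
  shows "treedepth_le (with_proj (mk_symmetric G)) (underlying_treedepth G)"
  unfolding underlying_treedepth_def
proof (rule LeastI)
  show "treedepth_le (with_proj (mk_symmetric G)) (card (verts G))"
    using assms by (intro few_vertices) (simp_all add: mk_symmetric_def)
qed


section \<open>Algorithms and running time\<close>

text \<open>
  Algorithms are the programs of the language WHILE of N. D. Jones (Computability and
  Complexity, MIT Press 1997), with binary trees as data and a unit cost for every evaluated
  operator. A constructor application stores two pointers, so values may be shared; with this
  measure, running times agree with those of multitape Turing machines up to a polynomial,
  and the classes of bounds used below are closed under polynomials.
\<close>

datatype data = Leaf | Node data data

datatype expr = Var nat | Const data | Cons expr expr | Hd expr | Tl expr

datatype com =
    Assign nat expr
  | Seq com com
  | If expr com com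
  | While expr com

type_synonym store = "nat \<Rightarrow> data"

primrec left :: "data \<Rightarrow> data" where
  "left Leaf = Leaf"
| "left (Node x y) = x"

primrec right :: "data \<Rightarrow> data" where
  "right Leaf = Leaf"
| "right (Node x y) = y"

primrec eval_expr :: "expr \<Rightarrow> store \<Rightarrow> data" where
  "eval_expr (Var i) s = s i"
| "eval_expr (Const d) s = d"
| "eval_expr (Cons e1 e2) s = Node (eval_expr e1 s) (eval_expr e2 s)"
| "eval_expr (Hd e) s = left (eval_expr e s)"
| "eval_expr (Tl e) s = right (eval_expr e s)"

primrec cost :: "expr \<Rightarrow> nat" where
  "cost (Var i) = 1"
| "cost (Const d) = 1"
| "cost (Cons e1 e2) = 1 + cost e1 + cost e2"
| "cost (Hd e) = 1 + cost e"
| "cost (Tl e) = 1 + cost e"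

text \<open>\<open>exec c s t s'\<close>: started in \<open>s\<close>, command \<open>c\<close> halts after \<open>t\<close> steps in \<open>s'\<close>.
  In tests, \<open>Leaf\<close> is false and every other tree is true.\<close>

inductive exec :: "com \<Rightarrow> store \<Rightarrow> nat \<Rightarrow> store \<Rightarrow> bool" where
  Assign: "exec (Assign i e) s (1 + cost e) (s(i := eval_expr e s))"
| Seq: "exec c1 s1 t1 s2 \<Longrightarrow> exec c2 s2 t2 s3 \<Longrightarrow> exec (Seq c1 c2) s1 (1 + t1 + t2) s3"
| IfTrue: "eval_expr e s \<noteq> Leaf \<Longrightarrow> exec c1 s t s' \<Longrightarrow> exec (If e c1 c2) s (1 + cost e + t) s'"
| IfFalse: "eval_expr e s = Leaf \<Longrightarrow> exec c2 s t s' \<Longrightarrow> exec (If e c1 c2) s (1 + cost e + t) s'"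
| WhileFalse: "eval_expr e s = Leaf \<Longrightarrow> exec (While e c) s (1 + cost e) s"
| WhileTrue: "eval_expr e s1 \<noteq> Leaf \<Longrightarrow> exec c s1 t1 s2 \<Longrightarrow> exec (While e c) s2 t2 s3 \<Longrightarrow>
    exec (While e c) s1 (1 + cost e + t1 + t2) s3"

lemma exec_deterministic:
  "exec c s t s' \<Longrightarrow> exec c s u s'' \<Longrightarrow> t = u \<and> s' = s''"
proof (induction arbitrary: u s'' rule: exec.induct)
  case Assign
  then show ?case by (auto elim: exec.cases)
next
  case Seq
  from Seq.prems show ?case by cases (auto dest: Seq.IH)
next
  case IfTrue
  from IfTrue.prems show ?case by cases (auto dest: IfTrue.IH simp: IfTrue.hyps)
next
  case IfFalse
  from IfFalse.prems show ?case by cases (auto dest: IfFalse.IH simp: IfFalse.hyps)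
next
  case WhileFalse
  from WhileFalse.prems show ?case by cases (auto simp: WhileFalse.hyps)
next
  case WhileTrue
  from WhileTrue.prems show ?case by cases (auto dest: WhileTrue.IH simp: WhileTrue.hyps)
qed

text \<open>Variable 0 holds the input and the answer; all other variables are initially \<open>Leaf\<close>.
  The predicate states that \<open>P\<close> halts on input \<open>x\<close> within the given bound and that its answer
  is \<open>yes\<close>.\<close>

definition answers_within :: "com \<Rightarrow> data \<Rightarrow> bool \<Rightarrow> real \<Rightarrow> bool" where
  "answers_within P x yes bound \<longleftrightarrow>
     (\<exists>t s. exec P ((\<lambda>_. Leaf)(0 := x)) t s \<and> real t \<le> bound \<and> (s 0 \<noteq> Leaf \<longleftrightarrow> yes))"


section \<open>Encoding of instances\<close>

primrec enc_bool :: "bool \<Rightarrow> data" where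
  "enc_bool False = Leaf"
| "enc_bool True = Node Leaf Leaf"

text \<open>Unary numbers; the encoding of an instance is still of size polynomial in its parameters.\<close>

primrec enc_nat :: "nat \<Rightarrow> data" where
  "enc_nat 0 = Leaf"
| "enc_nat (Suc n) = Node Leaf (enc_nat n)"

primrec enc_list :: "('a \<Rightarrow> data) \<Rightarrow> 'a list \<Rightarrow> data" where
  "enc_list f [] = Leaf"
| "enc_list f (x # xs) = Node (f x) (enc_list f xs)"

text \<open>Adjacency matrix of a digraph with vertex set \<open>{..<n}\<close>.\<close>

definition enc_digraph :: "nat \<Rightarrow> nat pair_pre_digraph \<Rightarrow> data" where
  "enc_digraph n G =
     enc_list (enc_list enc_bool) (map (\<lambda>u. map (\<lambda>v. (u, v) \<in> parcs G) [0..<n]) [0..<n])"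


section \<open>3-SAT and the Exponential Time Hypothesis\<close>

text \<open>The literal \<open>(x, b)\<close> is satisfied by the assignments that map the variable \<open>x\<close> to \<open>b\<close>.\<close>

type_synonym literal = "nat \<times> bool"
type_synonym clause = "literal list"
type_synonym cnf = "clause list"

definition is_3cnf :: "nat \<Rightarrow> cnf \<Rightarrow> bool" where
  "is_3cnf n F \<longleftrightarrow> (\<forall>C \<in> set F. length C \<le> 3 \<and> (\<forall>(x, b) \<in> set C. x < n))"

definition satisfiable :: "cnf \<Rightarrow> bool" where
  "satisfiable F \<longleftrightarrow> (\<exists>a :: nat \<Rightarrow> bool. \<forall>C \<in> set F. \<exists>(x, b) \<in> set C. a x = b)"

definition enc_literal :: "literal \<Rightarrow> data" where
  "enc_literal l = Node (enc_nat (fst l)) (enc_bool (snd l))"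

definition enc_cnf :: "nat \<Rightarrow> cnf \<Rightarrow> data" where
  "enc_cnf n F = Node (enc_nat n) (enc_list (enc_list enc_literal) F)"

text \<open>No algorithm solves 3-SAT with \<open>n\<close> variables and \<open>m\<close> clauses in time \<open>2\<^sup>o\<^sup>(\<^sup>n\<^sup>+\<^sup>m\<^sup>)\<close>.\<close>

definition ETH :: bool where
  "ETH \<longleftrightarrow> \<not> (\<exists>P. \<exists>g :: nat \<Rightarrow> real. g \<in> o(\<lambda>k. real k) \<and>
     (\<forall>n F. is_3cnf n F \<longrightarrow>
        answers_within P (enc_cnf n F) (satisfiable F) (2 powr g (n + length F))))"


section \<open>Running times for 2-coloring parameterized by treedepth\<close>

text \<open>
  Time \<open>td\<^sup>o\<^sup>(\<^sup>t\<^sup>d\<^sup>) n\<^sup>O\<^sup>(\<^sup>1\<^sup>)\<close> on loopless digraphs without parallel arcs (opposite arcs are allowed).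
  The null graph is left out because there the bound \<open>n\<^sup>d\<close> would be zero.
\<close>

definition decides_two_coloring_in_td_to_o_td :: "com \<Rightarrow> bool" where
  "decides_two_coloring_in_td_to_o_td P \<longleftrightarrow>
     (\<exists>f :: nat \<Rightarrow> real. f \<in> o(\<lambda>k. real k) \<and>
       (\<exists>(C :: real) (d :: nat). \<forall>(n :: nat) (G :: nat pair_pre_digraph).
          n > 0 \<and> pair_digraph G \<and> pverts G = {..<n} \<longrightarrow>
          (let td = underlying_treedepth (with_proj G) in
             answers_within P (enc_digraph n G) (colorable 2 (with_proj G))
               (C * real td powr f td * real n ^ d))))"

end

theory Submission
  imports Defs "HOL-Real_Asymp.Real_Asymp"
begin

text \<open>
  Let \<open>N = n + m + 1\<close> and split the variables into about \<open>n / l\<close> groups of \<open>l \<approx> log\<^sub>4 N\<close>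
  variables. The value of a group, one of \<open>2\<^sup>l \<le> 2 \<surd>N\<close> assignments, is stored as the position of a
  group vertex in a topological order relative to \<open>2\<^sup>l + 1\<close> palette vertices; all of these lie in
  one color class because of digons with a hub. Three literals can only be falsified jointly by the
  values of three groups, and each triple of values that falsifies a clause is excluded by a directed
  6-cycle: not all of its vertices can be in the color class of the hub, and a vertex in the other
  class pushes one of the three group vertices off its forbidden position, upwards or downwards.
  Deleting hub, palette and groups leaves components with 6 vertices, so the treedepth is
  \<open>O(N / log N)\<close>, and \<open>td\<^sup>o\<^sup>(\<^sup>t\<^sup>d\<^sup>)\<close> becomes \<open>2\<^sup>o\<^sup>(\<^sup>N\<^sup>)\<close>.
\<close>

section \<open>Polynomial-time WHILE programs\<close>

text \<open>With one deleted vertex per variable the treedepth would be about n, and n^o(n) is not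
  2^o(n): a logarithmic factor has to be saved. The position of one vertex among q others stores log
  q bits, so grouping saves exactly this factor: for t = O(N / log N), t log t = O(N). Base 4
  balances the sizes: with 2^l about the square root of N, the palette is negligible against n / l,
  while l is still of order log N and the number of triples of (group, value) pairs is polynomial. A
  single vertex can push a group off a position in only one direction, so each of the three pairs
  needs two vertices; this is why the cycle has length 6. The other obstacle is the machine model.
  The reduction has to be a WHILE program that runs before the given algorithm, so it is assembled
  from closure rules for polynomial-time functions. Subtrees are shared, hence running time does not
  control the size of trees, and both have to be bounded throughout.\<close>

definition pbound :: "(data \<Rightarrow> nat) \<Rightarrow> bool" where
  "pbound h \<longleftrightarrow> (\<exists>k. \<forall>x. h x \<le> (size x + 2) ^ k)"

lemma pbound_mono: "pbound h \<Longrightarrow> (\<And>x. g x \<le> h x) \<Longrightarrow> pbound g"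
  unfolding pbound_def by (meson order_trans)

lemma pbound_const: "pbound (\<lambda>_. c)"
  unfolding pbound_def
proof (intro exI allI)
  fix x :: data
  have "c \<le> 2 ^ c" by (rule less_imp_le) simp
  also have "\<dots> \<le> (size x + 2) ^ c" by (rule power_mono) auto
  finally show "c \<le> (size x + 2) ^ c" .
qed

lemma pbound_size: "pbound size"
  unfolding pbound_def by (rule exI[of _ 1]) auto

lemma pbound_mult:
  assumes "pbound g" "pbound h" shows "pbound (\<lambda>x. g x * h x)"
proof -
  from assms obtain k l where "\<And>x. g x \<le> (size x + 2) ^ k" "\<And>x. h x \<le> (size x + 2) ^ l"
    unfolding pbound_def by blast
  then have "g x * h x \<le> (size x + 2) ^ (k + l)" for x
    by (simp add: power_add mult_le_mono)
  then show ?thesis unfolding pbound_def by blast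
qed

text \<open>A sum is at most the product of the successors. The base \<open>size x + 2\<close> is at
  least 2, so adding 1 costs only one more factor.\<close>

lemma pbound_add:
  assumes "pbound g" "pbound h" shows "pbound (\<lambda>x. g x + h x)"
proof (rule pbound_mono)
  show "pbound (\<lambda>x. (g x + 1) * (h x + 1))"
  proof (rule pbound_mult)
    have suc: "pbound (\<lambda>x. f x + 1)" if "pbound f" for f
    proof -
      from that obtain k where k: "\<And>x. f x \<le> (size x + 2) ^ k" unfolding pbound_def by blast
      have "f x + 1 \<le> (size x + 2) ^ Suc k" for x
      proof -
        have "1 \<le> (size x + 2) ^ k" by simp
        with k[of x] have "f x + 1 \<le> 2 * (size x + 2) ^ k" by linarith
        then show ?thesis by simp
      qed
      then show ?thesis unfolding pbound_def by blast
    qed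
    show "pbound (\<lambda>x. g x + 1)" "pbound (\<lambda>x. h x + 1)" using assms suc by blast+
  qed
qed simp

lemma pbound_power: "pbound g \<Longrightarrow> pbound (\<lambda>x. g x ^ k)"
  by (induction k) (auto intro: pbound_mult pbound_const)

lemma pbound_compose:
  assumes "pbound h" "pbound (\<lambda>x. size (f x))" shows "pbound (\<lambda>x. h (f x))"
proof -
  from assms obtain k where "\<And>x. h x \<le> (size x + 2) ^ k" unfolding pbound_def by blast
  then show ?thesis
    by (intro pbound_mono[OF pbound_power[OF pbound_add[OF assms(2) pbound_const]]])
qed

lemmas pbound_intros = pbound_const pbound_size pbound_mult pbound_add pbound_power

section \<open>Programs with a frame condition and polynomial-time functions\<close>

text \<open>Scratch variables may hold anything at the start, so the program can be repeated inside
  loops; the frame bound \<open>m\<close> tells a caller which variables are safe for saving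
  values.\<close>

definition realizes :: "com \<Rightarrow> nat \<Rightarrow> (data \<Rightarrow> nat) \<Rightarrow> (data \<Rightarrow> data) \<Rightarrow> bool" where
  "realizes c m T f \<longleftrightarrow> (\<forall>s. \<exists>t s'. exec c s t s' \<and> s' 0 = f (s 0) \<and> (\<forall>i\<ge>m. s' i = s i) \<and> t \<le> T (s 0))"

text \<open>The size of the output is a separate condition because time does not imply it: repeating
  the assignment of \<open>Cons (Var 0) (Var 0)\<close> to variable 0 doubles a tree in constantly
  many steps. Without it the class would not be closed under composition.\<close>

definition ptime :: "(data \<Rightarrow> data) \<Rightarrow> bool" where
  "ptime f \<longleftrightarrow> pbound (\<lambda>x. size (f x)) \<and> (\<exists>c m T. pbound T \<and> realizes c m T f)"

lemma realizes_mono: "realizes c m T f \<Longrightarrow> m \<le> m' \<Longrightarrow> realizes c m' T f"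
  unfolding realizes_def by (meson order_trans)

lemma realizesE:
  assumes "realizes c m T f"
  obtains t s' where "exec c s t s'" "s' 0 = f (s 0)" "\<And>i. i \<ge> m \<Longrightarrow> s' i = s i" "t \<le> T (s 0)"
  using assms unfolding realizes_def by metis

lemma exec_AssignI: "t = 1 + cost e \<Longrightarrow> s' = s(i := eval_expr e s) \<Longrightarrow> exec (Assign i e) s t s'"
  using exec.Assign by simp

lemma ptime_size: "ptime f \<Longrightarrow> pbound (\<lambda>x. size (f x))"
  by (simp add: ptime_def)

lemma ptimeE:
  assumes "ptime f"
  obtains c m T where "pbound T" "\<And>m'. m' \<ge> m \<Longrightarrow> realizes c m' T f"
  using assms realizes_mono unfolding ptime_def by metis

lemma ptime_expr:
  assumes "\<And>s. eval_expr e s = f (s 0)" and "pbound (\<lambda>x. size (f x))"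
  shows "ptime f"
  unfolding ptime_def
proof (intro conjI exI)
  show "realizes (Assign 0 e) 1 (\<lambda>_. 1 + cost e) f"
    unfolding realizes_def
    by (intro allI exI conjI, rule exec_AssignI[OF refl refl]) (auto simp: assms(1))
qed (use assms in \<open>auto intro: pbound_const\<close>)

lemma ptime_id: "ptime (\<lambda>x. x)"
  by (rule ptime_expr[of "Var 0"]) (auto intro: pbound_size)

lemma ptime_const: "ptime (\<lambda>x. d)"
  by (rule ptime_expr[of "Const d"]) (auto intro: pbound_const)

lemma size_left: "size (left d) \<le> size d" by (cases d) auto
lemma size_right: "size (right d) \<le> size d" by (cases d) auto

lemma ptime_comp:
  assumes "ptime g" "ptime f" shows "ptime (\<lambda>x. g (f x))"
proof -
  from assms(1) obtain c2 m2 T2 where 2: "pbound T2" "\<And>m. m \<ge> m2 \<Longrightarrow> realizes c2 m T2 g" by (rule ptimeE) blast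
  from assms(2) obtain c1 m1 T1 where 1: "pbound T1" "\<And>m. m \<ge> m1 \<Longrightarrow> realizes c1 m T1 f" by (rule ptimeE) blast
  define m where "m = max m1 m2"
  have r: "realizes c1 m T1 f" "realizes c2 m T2 g" using 1 2 m_def by auto
  have "realizes (Seq c1 c2) m (\<lambda>x. 1 + T1 x + T2 (f x)) (\<lambda>x. g (f x))"
    unfolding realizes_def
  proof
    fix s :: store
    obtain t1 s1 where e1: "exec c1 s t1 s1" "s1 0 = f (s 0)" "\<And>i. i \<ge> m \<Longrightarrow> s1 i = s i" "t1 \<le> T1 (s 0)"
      by (rule realizesE[OF r(1), of s]) blast
    obtain t2 s2 where e2: "exec c2 s1 t2 s2" "s2 0 = g (s1 0)" "\<And>i. i \<ge> m \<Longrightarrow> s2 i = s1 i" "t2 \<le> T2 (s1 0)"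
      by (rule realizesE[OF r(2), of s1]) blast
    show "\<exists>t s'. exec (Seq c1 c2) s t s' \<and> s' 0 = g (f (s 0)) \<and> (\<forall>i\<ge>m. s' i = s i) \<and> t \<le> 1 + T1 (s 0) + T2 (f (s 0))"
      using exec.Seq[OF e1(1) e2(1)] e1 e2 by (intro exI[of _ "1 + t1 + t2"] exI[of _ s2]) auto
  qed
  moreover have "pbound (\<lambda>x. 1 + T1 x + T2 (f x))"
    by (intro pbound_intros 1 pbound_compose[OF 2(1)] ptime_size assms)
  moreover have "pbound (\<lambda>x. size (g (f x)))"
    using pbound_compose[OF ptime_size[OF assms(1)] ptime_size[OF assms(2)]] .
  ultimately show ?thesis unfolding ptime_def by blast
qed

lemma ptime_left: "ptime f \<Longrightarrow> ptime (\<lambda>x. left (f x))"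
  by (rule ptime_comp[of left], rule ptime_expr[of "Hd (Var 0)"])
    (auto intro: pbound_mono[OF pbound_size] size_left)

lemma ptime_right: "ptime f \<Longrightarrow> ptime (\<lambda>x. right (f x))"
  by (rule ptime_comp[of right], rule ptime_expr[of "Tl (Var 0)"])
    (auto intro: pbound_mono[OF pbound_size] size_right)

lemma ptime_Node:
  assumes "ptime f" "ptime g" shows "ptime (\<lambda>x. Node (f x) (g x))"
proof -
  from assms(1) obtain c1 m1 T1 where 1: "pbound T1" "\<And>m. m \<ge> m1 \<Longrightarrow> realizes c1 m T1 f" by (rule ptimeE) blast
  from assms(2) obtain c2 m2 T2 where 2: "pbound T2" "\<And>m. m \<ge> m2 \<Longrightarrow> realizes c2 m T2 g" by (rule ptimeE) blast
  define m where "m = max 1 (max m1 m2)"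
  have m: "m \<ge> 1" and r: "realizes c1 m T1 f" "realizes c2 m T2 g" using 1 2 by (auto simp: m_def)
  let ?c = "Seq (Assign m (Var 0)) (Seq c1 (Seq (Assign (Suc m) (Var 0)) (Seq (Assign 0 (Var m))
     (Seq c2 (Assign 0 (Cons (Var (Suc m)) (Var 0)))))))"
  \<comment> \<open>The four assignments cost 2 + 2 + 2 + 4 steps and the five sequencings one each,
    which gives 15.\<close>
  have "realizes ?c (m + 2) (\<lambda>x. 15 + T1 x + T2 x) (\<lambda>x. Node (f x) (g x))"
    unfolding realizes_def
  proof
    fix s :: store
    define s0 where "s0 = s(m := s 0)"
    obtain t1 s1 where e1: "exec c1 s0 t1 s1" "s1 0 = f (s0 0)" "\<And>i. i \<ge> m \<Longrightarrow> s1 i = s0 i" "t1 \<le> T1 (s0 0)"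
      by (rule realizesE[OF r(1), of s0]) blast
    define s2 where "s2 = s1(Suc m := s1 0)"
    define s3 where "s3 = s2(0 := s2 m)"
    obtain t2 s4 where e2: "exec c2 s3 t2 s4" "s4 0 = g (s3 0)" "\<And>i. i \<ge> m \<Longrightarrow> s4 i = s3 i" "t2 \<le> T2 (s3 0)"
      by (rule realizesE[OF r(2), of s3]) blast
    define s5 where "s5 = s4(0 := Node (s4 (Suc m)) (s4 0))"
    have a: "exec (Assign m (Var 0)) s 2 s0" "exec (Assign (Suc m) (Var 0)) s1 2 s2"
      "exec (Assign 0 (Var m)) s2 2 s3" "exec (Assign 0 (Cons (Var (Suc m)) (Var 0))) s4 4 s5"
      by (rule exec_AssignI; simp add: s0_def s2_def s3_def s5_def)+
    note e = exec.Seq[OF a(1) exec.Seq[OF e1(1) exec.Seq[OF a(2) exec.Seq[OF a(3) exec.Seq[OF e2(1) a(4)]]]]]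
    have s0: "s0 0 = s 0" using m by (auto simp: s0_def)
    have s3: "s3 0 = s 0" using m e1(3)[of m] by (auto simp: s3_def s2_def s0_def)
    show "\<exists>t s'. exec ?c s t s' \<and> s' 0 = Node (f (s 0)) (g (s 0)) \<and> (\<forall>i\<ge>m + 2. s' i = s i) \<and> t \<le> 15 + T1 (s 0) + T2 (s 0)"
      using e1 e2 m s0 s3
      by (intro exI conjI) (rule e, auto simp: s5_def s3_def s2_def s0_def)
  qed
  moreover have "pbound (\<lambda>x. 15 + T1 x + T2 x)"
    by (intro pbound_intros 1 2)
  moreover have "pbound (\<lambda>x. size (Node (f x) (g x)))"
    using pbound_add[OF pbound_add[OF ptime_size[OF assms(1)] ptime_size[OF assms(2)]] pbound_const[of 1]]
    by simp
  ultimately show ?thesis unfolding ptime_def by blast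
qed

lemma ptime_If:
  assumes "ptime b" "ptime f" "ptime g" shows "ptime (\<lambda>x. if b x = Leaf then f x else g x)"
proof -
  from assms(1) obtain c0 m0 T0 where 0: "pbound T0" "\<And>m. m \<ge> m0 \<Longrightarrow> realizes c0 m T0 b" by (rule ptimeE) blast
  from assms(2) obtain c1 m1 T1 where 1: "pbound T1" "\<And>m. m \<ge> m1 \<Longrightarrow> realizes c1 m T1 f" by (rule ptimeE) blast
  from assms(3) obtain c2 m2 T2 where 2: "pbound T2" "\<And>m. m \<ge> m2 \<Longrightarrow> realizes c2 m T2 g" by (rule ptimeE) blast
  define m where "m = max (max 1 m0) (max m1 m2)"
  have m: "m \<ge> 1" and r: "realizes c0 m T0 b" "realizes c1 m T1 f" "realizes c2 m T2 g"
    using 0 1 2 by (auto simp: m_def)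
  let ?A = "Assign 0 (Var m)"
  let ?c = "Seq (Assign m (Var 0)) (Seq c0 (If (Var 0) (Seq ?A c2) (Seq ?A c1)))"
  have "realizes ?c (m + 1) (\<lambda>x. 10 + T0 x + T1 x + T2 x) (\<lambda>x. if b x = Leaf then f x else g x)"
    unfolding realizes_def
  proof
    fix s :: store
    define s0 where "s0 = s(m := s 0)"
    obtain t1 s1 where e1: "exec c0 s0 t1 s1" "s1 0 = b (s0 0)" "\<And>i. i \<ge> m \<Longrightarrow> s1 i = s0 i" "t1 \<le> T0 (s0 0)"
      by (rule realizesE[OF r(1), of s0]) blast
    define s2 where "s2 = s1(0 := s1 m)"
    have a: "exec (Assign m (Var 0)) s 2 s0" "exec ?A s1 2 s2"
      by (rule exec_AssignI; simp add: s0_def s2_def)+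
    have s0: "s0 0 = s 0" using m by (auto simp: s0_def)
    have s2: "s2 0 = s 0" using m e1(3)[of m] by (auto simp: s2_def s0_def)
    show "\<exists>t s'. exec ?c s t s' \<and> s' 0 = (if b (s 0) = Leaf then f (s 0) else g (s 0)) \<and>
      (\<forall>i\<ge>m + 1. s' i = s i) \<and> t \<le> 10 + T0 (s 0) + T1 (s 0) + T2 (s 0)"
    proof (cases "b (s 0) = Leaf")
      case True
      obtain t2 s3 where e2: "exec c1 s2 t2 s3" "s3 0 = f (s2 0)" "\<And>i. i \<ge> m \<Longrightarrow> s3 i = s2 i" "t2 \<le> T1 (s2 0)"
        by (rule realizesE[OF r(2), of s2]) blast
      have ev: "eval_expr (Var 0) s1 = Leaf" using True e1 s0 by simp
      note e = exec.Seq[OF a(1) exec.Seq[OF e1(1) exec.IfFalse[OF ev exec.Seq[OF a(2) e2(1)]]]]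
      show ?thesis using e1 e2 m s0 s2 True
        by (intro exI conjI) (rule e, auto simp: s2_def s0_def)
    next
      case False
      obtain t2 s3 where e2: "exec c2 s2 t2 s3" "s3 0 = g (s2 0)" "\<And>i. i \<ge> m \<Longrightarrow> s3 i = s2 i" "t2 \<le> T2 (s2 0)"
        by (rule realizesE[OF r(3), of s2]) blast
      have ev: "eval_expr (Var 0) s1 \<noteq> Leaf" using False e1 s0 by simp
      note e = exec.Seq[OF a(1) exec.Seq[OF e1(1) exec.IfTrue[OF ev exec.Seq[OF a(2) e2(1)]]]]
      show ?thesis using e1 e2 m s0 s2 False
        by (intro exI conjI) (rule e, auto simp: s2_def s0_def)
    qed
  qed
  moreover have "pbound (\<lambda>x. 10 + T0 x + T1 x + T2 x)"
    by (intro pbound_intros 0 1 2)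
  moreover have "pbound (\<lambda>x. size (if b x = Leaf then f x else g x))"
    by (rule pbound_mono[OF pbound_add[OF ptime_size[OF assms(2)] ptime_size[OF assms(3)]]]) auto
  ultimately show ?thesis unfolding ptime_def by blast
qed

text \<open>The loop state is a tree whose left part is the remaining work. A test of the guard
  costs 3 steps, once per round and once at the exit.\<close>

lemma exec_While:
  assumes c: "realizes c m T f"
  shows "\<forall>j<n. left ((f ^^ j) (s 0)) \<noteq> Leaf \<Longrightarrow> left ((f ^^ n) (s 0)) = Leaf \<Longrightarrow>
    \<forall>j\<le>n. T ((f ^^ j) (s 0)) \<le> B \<Longrightarrow>
    \<exists>t s'. exec (While (Hd (Var 0)) c) s t s' \<and> s' 0 = (f ^^ n) (s 0) \<and> (\<forall>i\<ge>m. s' i = s i) \<and> t \<le> n * (B + 3) + 3"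
proof (induction n arbitrary: s)
  case 0
  then show ?case
    by (intro exI conjI) (rule exec.WhileFalse, auto)
next
  case (Suc n)
  obtain t1 s1 where e1: "exec c s t1 s1" "s1 0 = f (s 0)" "\<And>i. i \<ge> m \<Longrightarrow> s1 i = s i" "t1 \<le> T (s 0)"
    by (rule realizesE[OF c, of s]) blast
  have sh: "(f ^^ j) (s1 0) = (f ^^ Suc j) (s 0)" for j
    unfolding e1(2) by (simp only: funpow_Suc_right o_apply)
  obtain t2 s2 where e2: "exec (While (Hd (Var 0)) c) s1 t2 s2" "s2 0 = (f ^^ Suc n) (s 0)"
    "\<And>i. i \<ge> m \<Longrightarrow> s2 i = s1 i" "t2 \<le> n * (B + 3) + 3"
    using Suc.IH[of s1] Suc.prems unfolding sh by (metis Suc_le_mono Suc_less_eq)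
  have "eval_expr (Hd (Var 0)) s \<noteq> Leaf" using Suc.prems(1)[rule_format, of 0] by simp
  note e = exec.WhileTrue[OF this e1(1) e2(1)]
  have "t1 \<le> B" using e1(4) Suc.prems(3)[rule_format, of 0] by simp
  with e1 e2 show ?case by (intro exI conjI) (rule e, auto)
qed

text \<open>Iterating a polynomial-time function can make trees explode, so besides the number of
  rounds \<open>N\<close> a bound \<open>B\<close> on all intermediate states is demanded; each
  round is then polynomial in \<open>B x\<close>.\<close>

lemma ptime_while:
  assumes f: "ptime f" and h: "ptime h" and NB: "pbound N" "pbound B"
    and *: "\<And>x. \<exists>n\<le>N x. left ((f ^^ n) (h x)) = Leaf \<and> (\<forall>j<n. left ((f ^^ j) (h x)) \<noteq> Leaf) \<and>
      (\<forall>j\<le>n. size ((f ^^ j) (h x)) \<le> B x) \<and> g x = (f ^^ n) (h x)"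
  shows "ptime g"
proof -
  from f obtain c1 m1 T1 where 1: "pbound T1" "\<And>m. m \<ge> m1 \<Longrightarrow> realizes c1 m T1 f" by (rule ptimeE) blast
  from h obtain c0 m0 T0 where 0: "pbound T0" "\<And>m. m \<ge> m0 \<Longrightarrow> realizes c0 m T0 h" by (rule ptimeE) blast
  from 1(1) obtain k where k: "\<And>x. T1 x \<le> (size x + 2) ^ k" unfolding pbound_def by blast
  define m where "m = max m0 m1"
  have r: "realizes c0 m T0 h" "realizes c1 m T1 f"
    using 0 1 by (auto simp: m_def)
  let ?c = "Seq c0 (While (Hd (Var 0)) c1)"
  have "realizes ?c m (\<lambda>x. 1 + T0 x + (N x * ((B x + 2) ^ k + 3) + 3)) g"
    unfolding realizes_def
  proof
    fix s :: store
    obtain t1 s1 where e1: "exec c0 s t1 s1" "s1 0 = h (s 0)" "\<And>i. i \<ge> m \<Longrightarrow> s1 i = s i" "t1 \<le> T0 (s 0)"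
      by (rule realizesE[OF r(1), of s]) blast
    obtain n where n: "n \<le> N (s 0)" "left ((f ^^ n) (h (s 0))) = Leaf" "\<forall>j<n. left ((f ^^ j) (h (s 0))) \<noteq> Leaf"
      "\<forall>j\<le>n. size ((f ^^ j) (h (s 0))) \<le> B (s 0)" "g (s 0) = (f ^^ n) (h (s 0))"
      using * by blast
    have "\<forall>j\<le>n. T1 ((f ^^ j) (s1 0)) \<le> (B (s 0) + 2) ^ k"
      using n(4) unfolding e1(2) by (meson add_le_mono1 k order_trans power_mono zero_le)
    with exec_While[OF r(2), of n s1 "(B (s 0) + 2) ^ k"] n(2,3) e1(2)
    obtain t2 s2 where e2: "exec (While (Hd (Var 0)) c1) s1 t2 s2" "s2 0 = g (s 0)"
      "\<forall>i\<ge>m. s2 i = s1 i" "t2 \<le> n * ((B (s 0) + 2) ^ k + 3) + 3"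
      unfolding n(5) by auto
    note e = exec.Seq[OF e1(1) e2(1)]
    have "n * ((B (s 0) + 2) ^ k + 3) \<le> N (s 0) * ((B (s 0) + 2) ^ k + 3)"
      using n(1) by (rule mult_right_mono) simp
    then have "1 + t1 + t2 \<le> 1 + T0 (s 0) + (N (s 0) * ((B (s 0) + 2) ^ k + 3) + 3)"
      using e1(4) e2(4) by linarith
    with e e1(3) e2(2,3) show "\<exists>t s'. exec ?c s t s' \<and> s' 0 = g (s 0) \<and> (\<forall>i\<ge>m. s' i = s i) \<and>
       t \<le> 1 + T0 (s 0) + (N (s 0) * ((B (s 0) + 2) ^ k + 3) + 3)"
      by metis
  qed
  moreover have "pbound (\<lambda>x. 1 + T0 x + (N x * ((B x + 2) ^ k + 3) + 3))"
    by (intro pbound_intros 0 NB)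
  moreover have "pbound (\<lambda>x. size (g x))"
    by (rule pbound_mono[OF NB(2)]) (metis * order_refl)
  ultimately show ?thesis unfolding ptime_def by blast
qed

text \<open>Functions of several arguments are treated as functions of nested pairs. The same device
  passes an environment \<open>x\<close> to the bodies of folds, maps and filters.\<close>

lemma ptime_comp2:
  assumes "ptime (\<lambda>p. f (left p) (right p))" "ptime g" "ptime h"
  shows "ptime (\<lambda>x. f (g x) (h x))"
  using ptime_comp[OF assms(1) ptime_Node[OF assms(2,3)]] by simp

lemmas ptime_basic = ptime_id ptime_const ptime_left ptime_right ptime_Node ptime_If

abbreviation pdec :: "(data \<Rightarrow> bool) \<Rightarrow> bool" where
  "pdec P \<equiv> ptime (\<lambda>x. enc_bool (P x))"

lemma enc_bool_eq_Leaf [simp]: "enc_bool b = Leaf \<longleftrightarrow> \<not> b"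
  by (cases b) auto

lemma ptime_if:
  assumes "pdec P" "ptime f" "ptime g" shows "ptime (\<lambda>x. if P x then f x else g x)"
proof -
  have "(\<lambda>x. if P x then f x else g x) = (\<lambda>x. if enc_bool (P x) = Leaf then g x else f x)" by auto
  then show ?thesis using ptime_If[OF assms(1,3,2)] by simp
qed

lemma pdec_not: assumes "pdec P" shows "pdec (\<lambda>x. \<not> P x)"
proof -
  have "(\<lambda>x. enc_bool (\<not> P x)) = (\<lambda>x. if P x then enc_bool False else enc_bool True)" by auto
  then show ?thesis using ptime_if[OF assms ptime_const ptime_const] by metis
qed

lemma pdec_conj: assumes "pdec P" "pdec Q" shows "pdec (\<lambda>x. P x \<and> Q x)"
proof -
  have "(\<lambda>x. enc_bool (P x \<and> Q x)) = (\<lambda>x. if P x then enc_bool (Q x) else enc_bool False)" by auto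
  then show ?thesis using ptime_if[OF assms ptime_const] by metis
qed

lemma pdec_Leaf: assumes "ptime f" shows "pdec (\<lambda>x. f x = Leaf)"
proof -
  have "(\<lambda>x. enc_bool (f x = Leaf)) = (\<lambda>x. if f x = Leaf then enc_bool True else enc_bool False)" by auto
  then show ?thesis using ptime_If[OF assms ptime_const ptime_const] by metis
qed

section \<open>List processing in polynomial time\<close>

text \<open>Every tree is read as the list of the trees hanging off its right spine.\<close>

primrec dlist :: "data \<Rightarrow> data list" where
  "dlist Leaf = []"
| "dlist (Node x y) = x # dlist y"

abbreviation mk :: "data list \<Rightarrow> data" where
  "mk \<equiv> enc_list (\<lambda>x. x)"

lemma dlist_mk [simp]: "dlist (mk xs) = xs" by (induction xs) auto
lemma mk_dlist [simp]: "mk (dlist x) = x" by (induction x) auto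

lemma size_mk: "size (mk xs) = (\<Sum>x\<leftarrow>xs. size x + 1)" by (induction xs) auto

lemma size_dlist: "(\<Sum>x\<leftarrow>dlist d. size x + 1) = size d"
  by (metis mk_dlist size_mk)

lemma length_dlist_le: "length (dlist d) \<le> size d" by (induction d) auto
lemma size_dlist_elem: "x \<in> set (dlist d) \<Longrightarrow> size x \<le> size d" by (induction d) auto

lemma pbound_length: "ptime f \<Longrightarrow> pbound (\<lambda>x. length (dlist (f x)))"
  by (rule pbound_mono[OF ptime_size length_dlist_le])

text \<open>A while loop on states made of the remaining list, the environment \<open>x\<close> and
  the accumulator; \<open>B\<close> bounds the accumulator after every prefix of the list.\<close>

lemma ptime_fold:
  assumes l: "ptime l" and i: "ptime i"
    and f: "ptime (\<lambda>p. f (left (left p)) (right (left p)) (right p))"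
    and B: "pbound B" "\<And>x j. size (fold (f x) (take j (dlist (l x))) (i x)) \<le> B x"
  shows "ptime (\<lambda>x. fold (f x) (dlist (l x)) (i x))"
proof -
  define st where "st p = Node (right (left p)) (Node (left (right p))
     (f (left (right p)) (left (left p)) (right (right p))))" for p
  have "ptime (\<lambda>p. f (left (right p)) (left (left p)) (right (right p)))"
    using ptime_comp[OF f, of "\<lambda>p. Node (Node (left (right p)) (left (left p))) (right (right p))"]
    by (simp add: ptime_basic)
  then have st: "ptime st"
    unfolding st_def by (intro ptime_basic)
  have iter: "(st ^^ j) (Node d (Node x a)) = Node (mk (drop j (dlist d))) (Node x (fold (f x) (take j (dlist d)) a))"
    if "j \<le> length (dlist d)" for j d x a
    using that
  proof (induction j)
    case (Suc j)
    then have "drop j (dlist d) = dlist d ! j # drop (Suc j) (dlist d)"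
      by (simp add: Cons_nth_drop_Suc)
    with Suc show ?case by (simp add: st_def take_Suc_conv_app_nth)
  qed simp
  have sz: "size (mk (drop j xs)) \<le> size (mk xs)" for j xs
    unfolding size_mk by (metis append_take_drop_id le_add2 map_append sum_list_append)
  define g where "g x = Node Leaf (Node x (fold (f x) (dlist (l x)) (i x)))" for x
  have "ptime g"
  proof (rule ptime_while[OF st])
    show "ptime (\<lambda>x. Node (l x) (Node x (i x)))" by (intro ptime_basic l i)
    show "pbound (\<lambda>x. length (dlist (l x)))" by (rule pbound_length[OF l])
    show "pbound (\<lambda>x. size (l x) + (size x + B x + 1) + 1)"
      by (intro pbound_intros B ptime_size l)
    fix x
    let ?h = "Node (l x) (Node x (i x))" let ?n = "length (dlist (l x))"
    have "left ((st ^^ ?n) ?h) = Leaf" "g x = (st ^^ ?n) ?h"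
      by (simp_all add: iter g_def)
    moreover have "left ((st ^^ j) ?h) \<noteq> Leaf" if "j < ?n" for j
      using that by (simp add: iter Cons_nth_drop_Suc[symmetric])
    moreover have "size ((st ^^ j) ?h) \<le> size (l x) + (size x + B x + 1) + 1" if "j \<le> ?n" for j
      using that B(2)[where x = x and j = j] sz[of j "dlist (l x)"] by (simp add: iter)
    ultimately show "\<exists>n\<le>?n. left ((st ^^ n) ?h) = Leaf \<and> (\<forall>j<n. left ((st ^^ j) ?h) \<noteq> Leaf) \<and>
      (\<forall>j\<le>n. size ((st ^^ j) ?h) \<le> size (l x) + (size x + B x + 1) + 1) \<and> g x = (st ^^ n) ?h"
      by blast
  qed
  then have "ptime (\<lambda>x. right (right (g x)))" by (intro ptime_basic)
  then show ?thesis by (simp add: g_def)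
qed

text \<open>If a step adds at most \<open>B x\<close>, whatever the accumulator is, the growth is
  linear in the length of the list. Bounds that multiply the accumulator would not do.\<close>

lemma ptime_fold_additive:
  assumes l: "ptime l" and i: "ptime i"
    and f: "ptime (\<lambda>p. f (left (left p)) (right (left p)) (right p))"
    and B: "pbound B" "\<And>x e a. e \<in> set (dlist (l x)) \<Longrightarrow> size (f x e a) \<le> size a + B x"
  shows "ptime (\<lambda>x. fold (f x) (dlist (l x)) (i x))"
proof (rule ptime_fold[OF l i f])
  show "pbound (\<lambda>x. size (i x) + length (dlist (l x)) * B x)"
    by (intro pbound_intros ptime_size i pbound_length l B)
  fix x j
  have "size (fold (f x) ys a) \<le> size a + length ys * B x" if "set ys \<subseteq> set (dlist (l x))" for ys a
    using that
  proof (induction ys arbitrary: a)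
    case (Cons y ys)
    from Cons.IH[of "f x y a"] Cons.prems B(2)[of y x a] show ?case by simp
  qed simp
  from this[OF set_take_subset, of j] have
    "size (fold (f x) (take j (dlist (l x))) (i x)) \<le> size (i x) + length (take j (dlist (l x))) * B x" .
  also have "\<dots> \<le> size (i x) + length (dlist (l x)) * B x"
    by (intro add_left_mono mult_right_mono) auto
  finally show "size (fold (f x) (take j (dlist (l x))) (i x)) \<le> size (i x) + length (dlist (l x)) * B x" .
qed

lemma fold_Node: "fold Node xs (mk ys) = mk (rev xs @ ys)"
proof (induction xs arbitrary: ys)
  case (Cons x xs)
  from Cons[of "x # ys"] show ?case by simp
qed simp

text \<open>Pushing a list onto another reverses it, so the first list is reversed onto
  \<open>Leaf\<close> before it is pushed onto the second.\<close>

lemma ptime_append: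
  assumes "ptime f" "ptime g" shows "ptime (\<lambda>x. mk (dlist (f x) @ dlist (g x)))"
proof -
  have "ptime (\<lambda>x. fold ((\<lambda>_. Node) x) (dlist (h x)) (k x))" if "ptime h" "ptime k" for h k
  proof (rule ptime_fold_additive[OF that])
    show "pbound (\<lambda>x. size (h x) + 1)" by (intro pbound_intros ptime_size that)
    show "ptime (\<lambda>p. Node (right (left p)) (right p))" by (intro ptime_basic)
  qed (simp add: size_dlist_elem)
  from this[OF this[OF assms(1) ptime_const[of Leaf]] assms(2)] show ?thesis
    using fold_Node[of _ "[]"] fold_Node[of _ "dlist _"] by simp
qed

lemma ptime_rev:
  assumes "ptime f" shows "ptime (\<lambda>x. mk (rev (dlist (f x))))"
proof -
  have "ptime (\<lambda>x. fold ((\<lambda>_. Node) x) (dlist (f x)) Leaf)"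
  proof (rule ptime_fold_additive[OF assms ptime_const])
    show "pbound (\<lambda>x. size (f x) + 1)" by (intro pbound_intros ptime_size assms)
    show "ptime (\<lambda>p. Node (right (left p)) (right p))" by (intro ptime_basic)
  qed (simp add: size_dlist_elem)
  then show ?thesis
    using fold_Node[of _ "[]"] by simp
qed

text \<open>An entry is no larger than its list, so the result on \<open>x\<close> and an entry has
  a bound in terms of \<open>x\<close> alone, as the additive fold rule requires.\<close>

lemma pbound_env:
  assumes "ptime (\<lambda>p. f (left p) (right p))" "ptime l"
  obtains B where "pbound B" "\<And>x e. e \<in> set (dlist (l x)) \<Longrightarrow> size (f x e) \<le> B x"
proof -
  from ptime_size[OF assms(1)] obtain k where k: "\<And>p. size (f (left p) (right p)) \<le> (size p + 2) ^ k"
    unfolding pbound_def by blast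
  show ?thesis
  proof
    show "pbound (\<lambda>x. (size x + size (l x) + 1 + 2) ^ k)"
      by (intro pbound_intros ptime_size assms)
    fix x e assume "e \<in> set (dlist (l x))"
    then have "size (Node x e) + 2 \<le> size x + size (l x) + 1 + 2"
      by (simp add: size_dlist_elem)
    then have "(size (Node x e) + 2) ^ k \<le> (size x + size (l x) + 1 + 2) ^ k"
      by (rule power_mono) simp
    with k[of "Node x e"] show "size (f x e) \<le> (size x + size (l x) + 1 + 2) ^ k" by simp
  qed
qed

lemma ptime_map:
  assumes f: "ptime (\<lambda>p. f (left p) (right p))" and l: "ptime l"
  shows "ptime (\<lambda>x. mk (map (f x) (dlist (l x))))"
proof -
  obtain B where B: "pbound B" "\<And>x e. e \<in> set (dlist (l x)) \<Longrightarrow> size (f x e) \<le> B x"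
    by (rule pbound_env[OF f l]) blast
  have "ptime (\<lambda>x. fold ((\<lambda>e. Node (f x e))) (dlist (l x)) Leaf)"
  proof (rule ptime_fold_additive[OF l ptime_const])
    show "pbound (\<lambda>x. B x + 1)" by (intro pbound_intros B)
    show "ptime (\<lambda>p. Node (f (left (left p)) (right (left p))) (right p))"
      using ptime_comp[OF f ptime_left[OF ptime_id]] by (intro ptime_basic)
  qed (use B in auto)
  moreover have "fold (\<lambda>e. Node (f x e)) xs (mk ys) = mk (rev (map (f x) xs) @ ys)" for x xs ys
  proof (induction xs arbitrary: ys)
    case (Cons e xs)
    from Cons[of "f x e # ys"] show ?case by simp
  qed simp
  from this[of _ _ "[]"] have "fold (\<lambda>e. Node (f x e)) xs Leaf = mk (rev (map (f x) xs))" for x xs by simp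
  ultimately have "ptime (\<lambda>x. mk (rev (map (f x) (dlist (l x)))))" by simp
  from ptime_rev[OF this] show ?thesis by simp
qed

lemma ptime_filter:
  assumes P: "pdec (\<lambda>p. P (left p) (right p))" and l: "ptime l"
  shows "ptime (\<lambda>x. mk (filter (P x) (dlist (l x))))"
proof -
  have "ptime (\<lambda>x. fold ((\<lambda>e a. if P x e then Node e a else a)) (dlist (l x)) Leaf)"
  proof (rule ptime_fold_additive[OF l ptime_const])
    show "pbound (\<lambda>x. size (l x) + 1)" by (intro pbound_intros ptime_size l)
    show "ptime (\<lambda>p. if P (left (left p)) (right (left p)) then Node (right (left p)) (right p) else right p)"
      using ptime_comp[OF P ptime_left[OF ptime_id]] by (intro ptime_if ptime_basic)
  qed (auto dest: size_dlist_elem)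
  moreover have "fold (\<lambda>e a. if P x e then Node e a else a) xs (mk ys) = mk (rev (filter (P x) xs) @ ys)" for x xs ys
  proof (induction xs arbitrary: ys)
    case (Cons e xs)
    from Cons[of ys] Cons[of "e # ys"] show ?case by simp
  qed simp
  from this[of _ _ "[]"] have "fold (\<lambda>e a. if P x e then Node e a else a) xs Leaf = mk (rev (filter (P x) xs))" for x xs by simp
  ultimately have "ptime (\<lambda>x. mk (rev (filter (P x) (dlist (l x)))))" by simp
  from ptime_rev[OF this] show ?thesis by (simp add: rev_filter)
qed

lemma pdec_bex:
  assumes P: "pdec (\<lambda>p. P (left p) (right p))" and l: "ptime l"
  shows "pdec (\<lambda>x. \<exists>e\<in>set (dlist (l x)). P x e)"
proof -
  have "pdec (\<lambda>x. \<not> (mk (filter (P x) (dlist (l x))) = Leaf))"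
    by (intro pdec_not pdec_Leaf ptime_filter assms)
  moreover have "mk xs = Leaf \<longleftrightarrow> xs = []" for xs by (cases xs) auto
  ultimately show ?thesis by (simp add: filter_empty_conv)
qed

lemma ptime_concat:
  assumes l: "ptime l"
  shows "ptime (\<lambda>x. mk (concat (map dlist (dlist (l x)))))"
proof -
  have "ptime (\<lambda>x. fold (\<lambda>e a. mk (dlist e @ dlist a)) (dlist (mk (rev (dlist (l x))))) Leaf)"
  proof (rule ptime_fold_additive[OF ptime_rev[OF l] ptime_const])
    show "pbound (\<lambda>x. size (l x))" by (intro pbound_intros ptime_size l)
    show "ptime (\<lambda>p. mk (dlist (right (left p)) @ dlist (right p)))"
      by (intro ptime_append ptime_basic)
    fix x e a assume "e \<in> set (dlist (mk (rev (dlist (l x)))))"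
    then have "size e \<le> size (l x)" by (simp add: size_dlist_elem)
    then show "size (mk (dlist e @ dlist a)) \<le> size a + size (l x)"
      using size_dlist[of e] size_dlist[of a] by (simp add: size_mk)
  qed
  moreover have "fold (\<lambda>e a. mk (dlist e @ dlist a)) (rev xs) Leaf = mk (concat (map dlist xs))" for xs
    unfolding foldr_conv_fold[symmetric] by (induction xs) auto
  ultimately show ?thesis by simp
qed

section \<open>Deciding equality of trees\<close>

text \<open>Trees are compared with a stack of pairs that remain to be compared.\<close>

definition eq_step :: "data \<Rightarrow> data" where
  "eq_step p = (let x = left (left (left p)); y = right (left (left p)); s = right (left p) in
     if x = Leaf then (if y = Leaf then Node s (right p) else Node Leaf Leaf)
     else if y = Leaf then Node Leaf Leaf
     else Node (Node (Node (left x) (left y)) (Node (Node (right x) (right y)) s)) (right p))"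

lemma ptime_eq_step: "ptime eq_step"
  unfolding eq_step_def[abs_def] Let_def by (intro ptime_basic)

text \<open>\<open>2 * size t + 1\<close> counts all inner nodes and leaves of a tree
  \<open>t\<close>. A successful comparison uses up exactly one of them, so the weight is the number
  of rounds when all pairs agree.\<close>

definition stack_weight :: "data \<Rightarrow> nat" where
  "stack_weight s = (\<Sum>p\<leftarrow>dlist s. 2 * size (left p) + 1)"

definition stack_eq :: "data \<Rightarrow> bool" where
  "stack_eq s \<longleftrightarrow> (\<forall>p\<in>set (dlist s). left p = right p)"

text \<open>Replacing a pair of nodes by the two pairs of their children leaves the size of the
  stack unchanged and lowers its weight by one. A mismatch empties the stack and sets the answer to
  false, which ends the loop at once.\<close>

lemma eq_step_iterates:
  assumes "\<forall>p\<in>set (dlist s). p \<noteq> Leaf"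
  shows "\<exists>n\<le>stack_weight s. left ((eq_step ^^ n) (Node s (enc_bool True))) = Leaf \<and>
     (\<forall>j<n. left ((eq_step ^^ j) (Node s (enc_bool True))) \<noteq> Leaf) \<and>
     (\<forall>j\<le>n. size ((eq_step ^^ j) (Node s (enc_bool True))) \<le> size s + 2) \<and>
     right ((eq_step ^^ n) (Node s (enc_bool True))) = enc_bool (stack_eq s)"
  using assms
proof (induction "stack_weight s" arbitrary: s rule: less_induct)
  case less
  let ?P = "\<lambda>s n. left ((eq_step ^^ n) (Node s (enc_bool True))) = Leaf \<and>
   (\<forall>j<n. left ((eq_step ^^ j) (Node s (enc_bool True))) \<noteq> Leaf) \<and>
   (\<forall>j\<le>n. size ((eq_step ^^ j) (Node s (enc_bool True))) \<le> size s + 2) \<and>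
   right ((eq_step ^^ n) (Node s (enc_bool True))) = enc_bool (stack_eq s)"
  show ?case
  proof (cases s)
    case Leaf
    then show ?thesis by (intro exI[of _ 0]) (auto simp: stack_eq_def)
  next
    case (Node p r)
    with less.prems obtain x y where p: "p = Node x y" by (cases p) auto
    show ?thesis
    proof (cases "x = Leaf \<longleftrightarrow> y = Leaf")
      case False
      then have "eq_step (Node s (enc_bool True)) = Node Leaf Leaf"
        by (auto simp: eq_step_def Node p)
      moreover from False have "\<not> stack_eq s" by (auto simp: stack_eq_def Node p)
      ultimately show ?thesis
        by (intro exI[of _ 1] conjI) (auto simp: Node p le_Suc_eq[of _ 0] stack_weight_def)
    next
      case True
      define s' where "s' = (if x = Leaf then r else
        Node (Node (left x) (left y)) (Node (Node (right x) (right y)) r))"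
      have st: "eq_step (Node s (enc_bool True)) = Node s' (enc_bool True)"
        using True by (auto simp: eq_step_def Node p s'_def)
      have w: "stack_weight s = Suc (stack_weight s')"
        using True by (cases x) (auto simp: stack_weight_def Node p s'_def)
      have sz: "size s' \<le> size s"
        using True by (cases x; cases y) (auto simp: Node p s'_def)
      have eq: "stack_eq s' = stack_eq s"
        using True by (cases x; cases y) (auto simp: Node p s'_def stack_eq_def)
      have "\<forall>p\<in>set (dlist s'). p \<noteq> Leaf"
        using less.prems by (auto simp: s'_def Node)
      with less.hyps[of s'] w obtain n where n: "n \<le> stack_weight s'" "?P s' n" by auto
      have sh: "(eq_step ^^ Suc j) (Node s (enc_bool True)) = (eq_step ^^ j) (Node s' (enc_bool True))" for j
        by (simp only: funpow_Suc_right o_apply st)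
      have "left ((eq_step ^^ j) (Node s (enc_bool True))) \<noteq> Leaf" if "j < Suc n" for j
        using that n(2) sh by (cases j) (auto simp: Node simp del: funpow.simps(2))
      moreover have "size ((eq_step ^^ j) (Node s (enc_bool True))) \<le> size s + 2" if "j \<le> Suc n" for j
      proof (cases j)
        case (Suc i)
        with n(2) that have "size ((eq_step ^^ i) (Node s' (enc_bool True))) \<le> size s' + 2" by auto
        then show ?thesis using sz unfolding Suc sh by linarith
      qed simp
      ultimately show ?thesis using n w eq sh
        by (intro exI[of _ "Suc n"]) (simp del: funpow.simps(2))
    qed
  qed
qed

lemma pdec_eq:
  assumes f: "ptime f" and g: "ptime g" shows "pdec (\<lambda>x. f x = g x)"
proof -
  define h where "h x = Node (Node (f x) (g x)) Leaf" for x
  have h: "ptime h" unfolding h_def[abs_def] by (intro ptime_basic f g)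
  have ex: "\<exists>n\<le>stack_weight (h x). left ((eq_step ^^ n) (Node (h x) (enc_bool True))) = Leaf \<and>
     (\<forall>j<n. left ((eq_step ^^ j) (Node (h x) (enc_bool True))) \<noteq> Leaf) \<and>
     (\<forall>j\<le>n. size ((eq_step ^^ j) (Node (h x) (enc_bool True))) \<le> size (h x) + 2) \<and>
     right ((eq_step ^^ n) (Node (h x) (enc_bool True))) = enc_bool (stack_eq (h x))" for x
    by (rule eq_step_iterates) (simp add: h_def)
  have "ptime (\<lambda>x. Node Leaf (enc_bool (stack_eq (h x))))"
  proof (rule ptime_while[OF ptime_eq_step])
    show "ptime (\<lambda>x. Node (h x) (enc_bool True))" by (intro ptime_basic h)
    show "pbound (\<lambda>x. stack_weight (h x))"
      unfolding stack_weight_def h_def by (simp del: add_Suc_right, intro pbound_intros ptime_size f)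
    show "pbound (\<lambda>x. size (h x) + 2)" by (intro pbound_intros ptime_size h)
    show "\<exists>n\<le>stack_weight (h x). left ((eq_step ^^ n) (Node (h x) (enc_bool True))) = Leaf \<and>
      (\<forall>j<n. left ((eq_step ^^ j) (Node (h x) (enc_bool True))) \<noteq> Leaf) \<and>
      (\<forall>j\<le>n. size ((eq_step ^^ j) (Node (h x) (enc_bool True))) \<le> size (h x) + 2) \<and>
      Node Leaf (enc_bool (stack_eq (h x))) = (eq_step ^^ n) (Node (h x) (enc_bool True))" for x
    proof -
      have ne: "eq_step y \<noteq> Leaf" for y by (simp add: eq_step_def Let_def)
      have "y \<noteq> Leaf \<Longrightarrow> left y = Leaf \<Longrightarrow> y = Node Leaf (right y)" for y by (cases y) auto
      moreover have "(eq_step ^^ n) (Node (h x) (enc_bool True)) \<noteq> Leaf" for n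
        using ne by (cases n) auto
      ultimately show ?thesis using ex[of x] by metis
    qed
  qed
  from ptime_right[OF this] show ?thesis by (simp add: stack_eq_def h_def)
qed

section \<open>Colorings and treedepth of digraphs on indices\<close>

lemma acyclic_hom:
  assumes "acyclic S" "\<And>x y. (x, y) \<in> R \<Longrightarrow> (f x, f y) \<in> S"
  shows "acyclic R"
proof -
  have "(f x, f y) \<in> S\<^sup>+" if "(x, y) \<in> R\<^sup>+" for x y
    using that by induction (use assms(2) in \<open>auto intro: trancl_into_trancl\<close>)
  then show ?thesis using assms(1) unfolding acyclic_def by blast
qed

text \<open>Every closed walk contains a cycle, so cycles can be replaced by loops in the transitive
  closure of the arc relation.\<close>

lemma acyclic_digraph_iff:
  assumes "wf_digraph H" shows "acyclic_digraph H \<longleftrightarrow> acyclic (arcs_ends H)"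
proof -
  interpret wf_digraph H by fact
  have "(\<exists>p. cycle p) \<longleftrightarrow> (\<exists>p. closed_w p)"
    using closed_w_imp_cycle by (auto simp: cycle_altdef)
  then show ?thesis
    unfolding acyclic_digraph_def acyclic_def closed_w_def reachable1_awalk by auto
qed

text \<open>With Boolean colors, \<open>c\<close> can range over all functions on the type: arcs
  have both ends among the vertices, so colors elsewhere have no effect.\<close>

lemma colorable_2_iff:
  assumes "pair_wf_digraph G"
  shows "colorable 2 (with_proj G) \<longleftrightarrow> (\<exists>c. \<forall>b::bool. acyclic {(u, v) \<in> parcs G. c u = b \<and> c v = b})"
proof -
  interpret pair_wf_digraph G by fact
  have ac: "acyclic_digraph (with_proj G \<restriction> {v \<in> pverts G. P v}) \<longleftrightarrow> acyclic {(u, v) \<in> parcs G. P u \<and> P v}" for P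
  proof -
    have "wf_digraph (with_proj G \<restriction> {v \<in> pverts G. P v})" by (rule wellformed_induce_subgraph)
    moreover have "arcs_ends (with_proj G \<restriction> {v \<in> pverts G. P v}) = {(u, v) \<in> parcs G. P u \<and> P v}"
      by (auto simp: arcs_ends_conv in_arcsD1 in_arcsD2)
    ultimately show ?thesis by (simp add: acyclic_digraph_iff)
  qed
  have "colorable 2 (with_proj G) \<longleftrightarrow> (\<exists>c :: 'a \<Rightarrow> nat. (\<forall>v\<in>pverts G. c v < 2) \<and>
      (\<forall>i<2. acyclic {(u, v) \<in> parcs G. c u = i \<and> c v = i}))"
    by (simp add: colorable_def ac)
  also have "\<dots> \<longleftrightarrow> (\<exists>c. \<forall>b::bool. acyclic {(u, v) \<in> parcs G. c u = b \<and> c v = b})" (is "?L \<longleftrightarrow> ?R")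
  proof
    assume ?L
    then obtain c :: "'a \<Rightarrow> nat" where c: "\<forall>v\<in>pverts G. c v < 2" "\<forall>i<2. acyclic {(u, v) \<in> parcs G. c u = i \<and> c v = i}"
      by blast
    have "acyclic {(u, v) \<in> parcs G. (c u = 0) = b \<and> (c v = 0) = b}" for b
    proof (cases b)
      case True
      then show ?thesis using c(2)[rule_format, of 0] by simp
    next
      case False
      have "{(u, v) \<in> parcs G. c u \<noteq> 0 \<and> c v \<noteq> 0} \<subseteq> {(u, v) \<in> parcs G. c u = 1 \<and> c v = 1}"
      proof (intro subrelI)
        fix u v assume "(u, v) \<in> {(u, v) \<in> parcs G. c u \<noteq> 0 \<and> c v \<noteq> 0}"
        then have uv: "(u, v) \<in> parcs G" "c u \<noteq> 0" "c v \<noteq> 0" by simp_all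
        have "c u < 2" "c v < 2" using c(1) in_arcsD1[OF uv(1)] in_arcsD2[OF uv(1)] by simp_all
        with uv show "(u, v) \<in> {(u, v) \<in> parcs G. c u = 1 \<and> c v = 1}" by simp
      qed
      from acyclic_subset[OF _ this] c(2)[rule_format, of 1] False show ?thesis by simp
    qed
    then show ?R by (intro exI[of _ "\<lambda>v. c v = 0"]) simp
  next
    assume ?R
    then obtain c :: "'a \<Rightarrow> bool" where c: "\<And>b. acyclic {(u, v) \<in> parcs G. c u = b \<and> c v = b}" by blast
    have "acyclic {(u, v) \<in> parcs G. of_bool (c u) = i \<and> of_bool (c v) = i}" if "i < 2" for i :: nat
    proof (cases "i = 0")
      case True
      then show ?thesis using c[of False] by simp
    next
      case False
      then have "i = 1" using that by simp
      then show ?thesis using c[of True] by (simp del: One_nat_def)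
    qed
    then show ?L by (intro exI[of _ "\<lambda>v. of_bool (c v)"]) auto
  qed
  finally show ?thesis .
qed

section \<open>Treedepth after the deletion of a set of vertices\<close>

lemma card_strongly_connected_le:
  assumes sc: "strongly_connected K" and wf: "wf_digraph K"
    and lab: "\<And>u v. (u, v) \<in> arcs_ends K \<Longrightarrow> lab u = lab v"
    and V: "verts K \<subseteq> V" "finite V" "\<And>l. card {v \<in> V. lab v = l} \<le> s"
  shows "finite (verts K) \<and> card (verts K) \<le> s"
proof -
  interpret wf_digraph K by fact
  obtain u where u: "u \<in> verts K" using sc unfolding strongly_connected_def by auto
  have "lab v = lab w" if "v \<rightarrow>\<^sup>*\<^bsub>K\<^esub> w" for v w
    using that by induction (auto dest: lab)
  then have K: "verts K \<subseteq> {v \<in> V. lab v = lab u}"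
    using sc u V(1) unfolding strongly_connected_def by blast
  have "finite {v \<in> V. lab v = lab u}" using V(2) by simp
  from finite_subset[OF K this] card_mono[OF this K] V(3)[of "lab u"] show ?thesis by linarith
qed

text \<open>Labels are constant along arcs, hence on components, so each component fits into one
  label class and the base case of treedepth applies. Connectedness of \<open>H\<close> means strong
  connectedness of its symmetric closure, which is why the connected case argues about
  \<open>mk_symmetric H\<close>.\<close>

lemma treedepth_le_small_components:
  assumes wf: "wf_digraph H" and fin: "finite (verts H)"
    and lab: "\<And>a. a \<in> arcs H \<Longrightarrow> lab (tail H a) = lab (head H a)"
    and s: "\<And>l. card {v \<in> verts H. lab v = l} \<le> s"
  shows "treedepth_le H s"
proof (cases "connected H")
  case True
  have "wf_digraph (with_proj (mk_symmetric H))"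
    using wf by (auto simp: wf_digraph_wp_iff pair_wf_digraph_def mk_symmetric_def wf_digraph_def)
  moreover have "\<And>u v. (u, v) \<in> arcs_ends (with_proj (mk_symmetric H)) \<Longrightarrow> lab u = lab v"
    using lab by (auto simp: mk_symmetric_def)
  moreover have "verts (with_proj (mk_symmetric H)) \<subseteq> verts H" by (simp add: mk_symmetric_def)
  ultimately have "card (verts (with_proj (mk_symmetric H))) \<le> s"
    using card_strongly_connected_le[OF _ _ _ _ fin s, of "with_proj (mk_symmetric H)"] True unfolding connected_def
    by blast
  then show ?thesis using fin by (intro few_vertices) (simp_all add: mk_symmetric_def)
next
  case False
  show ?thesis
  proof (rule disconnected[OF False])
    fix K assume "K \<in> pre_digraph.sccs H"
    then have K: "induced_subgraph K H" "strongly_connected K" by (auto simp: pre_digraph.sccs_def)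
    then have sub: "subgraph K H" by (simp add: induced_subgraph_def)
    then have "lab u = lab v" if "(u, v) \<in> arcs_ends K" for u v
      using that lab by (auto simp: arcs_ends_conv subgraph_def compatible_def)
    with card_strongly_connected_le[OF K(2) _ _ _ fin s] sub show "treedepth_le K s"
      by (intro few_vertices) (auto simp: subgraph_def)
  qed
qed

lemma treedepth_le_delete:
  assumes "finite M" "M \<subseteq> verts H" "wf_digraph H" "finite (verts H)"
    and "\<And>a. a \<in> arcs H \<Longrightarrow> tail H a \<notin> M \<Longrightarrow> head H a \<notin> M \<Longrightarrow> lab (tail H a) = lab (head H a)"
    and "\<And>l. card {v \<in> verts H - M. lab v = l} \<le> s"
  shows "treedepth_le H (card M + s)"
  using assms
proof (induction M arbitrary: H rule: finite_induct)
  case empty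
  then show ?case using treedepth_le_small_components[of H lab s] by simp
next
  case (insert u M)
  have "treedepth_le (pre_digraph.del_vert H u) (card M + s)"
  proof (rule insert.IH)
    show "wf_digraph (pre_digraph.del_vert H u)"
      using insert.prems by (simp add: wf_digraph.wf_digraph_del_vert)
    show "M \<subseteq> verts (pre_digraph.del_vert H u)" using insert by (auto simp: pre_digraph.del_vert_simps)
    show "card {v \<in> verts (pre_digraph.del_vert H u) - M. lab v = l} \<le> s" for l
    proof -
      have "verts (pre_digraph.del_vert H u) - M = verts H - insert u M" by (auto simp: pre_digraph.del_vert_simps)
      then show ?thesis using insert.prems(5)[of l] by simp
    qed
  qed (use insert in \<open>auto simp: pre_digraph.del_vert_simps\<close>)
  then show ?case using insert delete_vertex[of u H "card M + s"] by simp
qed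

section \<open>Digraphs on the positions of a list\<close>

text \<open>Encoded instances have vertex set \<open>{..<n}\<close>. Naming a vertex by its position
  in \<open>vs\<close> allows the construction itself to be studied on a type of its own.\<close>

definition list_digraph :: "'v list \<Rightarrow> ('v \<times> 'v) set \<Rightarrow> nat pair_pre_digraph" where
  "list_digraph vs A = \<lparr>pverts = {..<length vs},
     parcs = {(i, j). i < length vs \<and> j < length vs \<and> (vs ! i, vs ! j) \<in> A}\<rparr>"

lemma pair_digraph_list_digraph:
  assumes "irrefl A" shows "pair_digraph (list_digraph vs A)"
proof
  show "finite (parcs (list_digraph vs A))"
    by (rule finite_subset[of _ "{..<length vs} \<times> {..<length vs}"]) (auto simp: list_digraph_def)
qed (use assms in \<open>auto simp: list_digraph_def irrefl_def\<close>)

lemma colorable_list_digraph: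
  assumes "irrefl A" "A \<subseteq> set vs \<times> set vs" "distinct vs"
  shows "colorable 2 (with_proj (list_digraph vs A)) \<longleftrightarrow>
    (\<exists>c. \<forall>b::bool. acyclic {(u, v) \<in> A. c u = b \<and> c v = b})"
proof -
  interpret pair_digraph "list_digraph vs A" by (rule pair_digraph_list_digraph[OF assms(1)])
  have wf: "pair_wf_digraph (list_digraph vs A)" by unfold_locales
  define idx where "idx v = (SOME i. i < length vs \<and> vs ! i = v)" for v
  have idx: "idx v < length vs \<and> vs ! idx v = v" if "v \<in> set vs" for v
    unfolding idx_def by (rule someI_ex) (use that in \<open>auto simp: in_set_conv_nth\<close>)
  have idx': "idx (vs ! i) = i" if "i < length vs" for i
    using idx[of "vs ! i"] that assms(3) nth_eq_iff_index_eq by fastforce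
  show ?thesis unfolding colorable_2_iff[OF wf]
  proof safe
    fix c :: "nat \<Rightarrow> bool" assume c: "\<forall>b. acyclic {(u, v) \<in> parcs (list_digraph vs A). c u = b \<and> c v = b}"
    show "\<exists>c. \<forall>b::bool. acyclic {(u, v) \<in> A. c u = b \<and> c v = b}"
    proof (intro exI allI)
      show "acyclic {(u, v) \<in> A. c (idx u) = b \<and> c (idx v) = b}" for b
        by (rule acyclic_hom[OF c[rule_format, of b], of _ idx])
          (use assms(2) idx in \<open>auto simp: list_digraph_def\<close>)
    qed
  next
    fix c :: "'a \<Rightarrow> bool" assume c: "\<forall>b. acyclic {(u, v) \<in> A. c u = b \<and> c v = b}"
    show "\<exists>c. \<forall>b::bool. acyclic {(u, v) \<in> parcs (list_digraph vs A). c u = b \<and> c v = b}"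
    proof (intro exI allI)
      show "acyclic {(u, v) \<in> parcs (list_digraph vs A). c (vs ! u) = b \<and> c (vs ! v) = b}" for b
        by (rule acyclic_hom[OF c[rule_format, of b], of _ "\<lambda>i. vs ! i"])
          (auto simp: list_digraph_def)
    qed
  qed
qed

lemma underlying_treedepth_list_digraph_le:
  assumes A: "irrefl A" and M: "M \<subseteq> set vs" and vs: "distinct vs"
    and lab: "\<And>u v. (u, v) \<in> A \<Longrightarrow> u \<notin> M \<Longrightarrow> v \<notin> M \<Longrightarrow> lab u = lab v"
    and s: "\<And>l. card {v \<in> set vs - M. lab v = l} \<le> s"
  shows "underlying_treedepth (with_proj (list_digraph vs A)) \<le> card M + s"
  unfolding underlying_treedepth_def
proof (rule Least_le)
  let ?H = "with_proj (mk_symmetric (with_proj (list_digraph vs A)))"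
  let ?n = "length vs"
  define N where "N = {i. i < ?n \<and> vs ! i \<in> M}"
  have inj: "inj_on (\<lambda>i. vs ! i) {..<?n}" using vs by (auto simp: inj_on_def nth_eq_iff_index_eq)
  have "(\<lambda>i. vs ! i) ` N = M" using M by (force simp: N_def in_set_conv_nth)
  moreover have "inj_on (\<lambda>i. vs ! i) N" by (rule inj_on_subset[OF inj]) (auto simp: N_def)
  ultimately have cN: "card N = card M" by (metis card_image)
  have v: "pverts (mk_symmetric (with_proj (list_digraph vs A))) = {..<?n}"
    by (simp add: mk_symmetric_def list_digraph_def)
  have a: "(i, j) \<in> parcs (mk_symmetric (with_proj (list_digraph vs A))) \<Longrightarrow>
     i < ?n \<and> j < ?n \<and> ((vs ! i, vs ! j) \<in> A \<or> (vs ! j, vs ! i) \<in> A)" for i j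
    by (auto simp: mk_symmetric_def list_digraph_def)
  have "treedepth_le ?H (card N + s)"
  proof (rule treedepth_le_delete[where lab = "\<lambda>i. lab (vs ! i)"])
    show "finite N" "N \<subseteq> verts ?H" "finite (verts ?H)" using v by (auto simp: N_def)
    show "wf_digraph ?H"
      unfolding wf_digraph_wp_iff by unfold_locales (use a v in \<open>force+\<close>)
    show "lab (vs ! tail ?H e) = lab (vs ! head ?H e)"
      if "e \<in> arcs ?H" "tail ?H e \<notin> N" "head ?H e \<notin> N" for e
    proof (cases e)
      case (Pair i j)
      with that a[of i j] have "i < ?n" "j < ?n" "(vs ! i, vs ! j) \<in> A \<or> (vs ! j, vs ! i) \<in> A" by auto
      then show ?thesis using that lab[of "vs ! i" "vs ! j"] lab[of "vs ! j" "vs ! i"] by (auto simp: Pair N_def)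
    qed
    show "card {i \<in> verts ?H - N. lab (vs ! i) = l} \<le> s" for l
    proof -
      have "card {i \<in> verts ?H - N. lab (vs ! i) = l} = card ((\<lambda>i. vs ! i) ` {i \<in> verts ?H - N. lab (vs ! i) = l})"
        by (rule card_image[symmetric], rule inj_on_subset[OF inj]) (auto simp: list_digraph_def)
      also have "\<dots> \<le> card {v \<in> set vs - M. lab v = l}"
        by (rule card_mono) (auto simp: N_def list_digraph_def)
      finally show ?thesis using s[of l] by simp
    qed
  qed
  then show "treedepth_le ?H (card M + s)" by (simp add: cN)
qed

section \<open>The graph of a formula\<close>

datatype vertex = Hub | Pal nat | Grp nat | Gad "(nat \<times> nat) list" nat

text \<open>
  The value of group \<open>i\<close> is the largest \<open>a\<close> such that \<open>Pal a\<close> reaches \<open>Grp i\<close> in the color class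
  opposite to \<open>Hub\<close>. For \<open>k < 3\<close> and \<open>T ! k = (i, a)\<close>, the vertex \<open>Gad T k\<close> in that class makes the
  value of \<open>i\<close> smaller than \<open>a\<close>, and \<open>Gad T (k + 3)\<close> makes it larger.
\<close>

inductive_set red_arcs :: "nat \<Rightarrow> nat \<Rightarrow> (nat \<times> nat) list set \<Rightarrow> (vertex \<times> vertex) set"
  for q r :: nat and Ts :: "(nat \<times> nat) list set" where
  hub_pal: "a \<le> q \<Longrightarrow> (Hub, Pal a) \<in> red_arcs q r Ts"
| pal_hub: "a \<le> q \<Longrightarrow> (Pal a, Hub) \<in> red_arcs q r Ts"
| hub_grp: "i < r \<Longrightarrow> (Hub, Grp i) \<in> red_arcs q r Ts"
| grp_hub: "i < r \<Longrightarrow> (Grp i, Hub) \<in> red_arcs q r Ts"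
| first: "i < r \<Longrightarrow> (Pal 0, Grp i) \<in> red_arcs q r Ts"
| last: "i < r \<Longrightarrow> (Grp i, Pal q) \<in> red_arcs q r Ts"
| cyc: "T \<in> Ts \<Longrightarrow> k < 6 \<Longrightarrow> (Gad T k, Gad T (Suc k mod 6)) \<in> red_arcs q r Ts"
| lo_in: "T \<in> Ts \<Longrightarrow> k < 3 \<Longrightarrow> (Grp (fst (T ! k)), Gad T k) \<in> red_arcs q r Ts"
| lo_out: "T \<in> Ts \<Longrightarrow> k < 3 \<Longrightarrow> (Gad T k, Pal (snd (T ! k))) \<in> red_arcs q r Ts"
| hi_in: "T \<in> Ts \<Longrightarrow> k < 3 \<Longrightarrow> (Pal (Suc (snd (T ! k))), Gad T (k + 3)) \<in> red_arcs q r Ts"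
| hi_out: "T \<in> Ts \<Longrightarrow> k < 3 \<Longrightarrow> (Gad T (k + 3), Grp (fst (T ! k))) \<in> red_arcs q r Ts"

definition red_verts :: "nat \<Rightarrow> nat \<Rightarrow> (nat \<times> nat) list set \<Rightarrow> vertex set" where
  "red_verts q r Ts = insert Hub (Pal ` {..q} \<union> Grp ` {..<r} \<union> (\<lambda>(T, k). Gad T k) ` (Ts \<times> {..<6}))"

text \<open>Entries may repeat; this covers clauses that touch fewer than three groups.\<close>

definition triples :: "nat \<Rightarrow> nat \<Rightarrow> (nat \<times> nat) list set" where
  "triples q r = {T. length T = 3 \<and> set T \<subseteq> {..<r} \<times> {..<q}}"

lemma triples_nth:
  assumes "T \<in> triples q r" "k < 3" shows "fst (T ! k) < r" "snd (T ! k) < q"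
proof -
  have "T ! k \<in> {..<r} \<times> {..<q}" using assms by (auto simp: triples_def)
  then show "fst (T ! k) < r" "snd (T ! k) < q" by (auto simp: mem_Times_iff)
qed

lemma red_arcs_subset:
  assumes "Ts \<subseteq> triples q r" shows "red_arcs q r Ts \<subseteq> red_verts q r Ts \<times> red_verts q r Ts"
proof (rule subrelI)
  have G: "Gad T k \<in> red_verts q r Ts" if "T \<in> Ts" "k < 6" for T k
    using that by (force simp: red_verts_def)
  fix u v assume "(u, v) \<in> red_arcs q r Ts"
  then show "(u, v) \<in> red_verts q r Ts \<times> red_verts q r Ts"
  proof cases
    case (cyc T k) then show ?thesis using G[of T k] G[of T "Suc k mod 6"] by simp
  next
    case (lo_in T k) then show ?thesis using assms triples_nth[of T q r k] G[of T k] by (auto simp: red_verts_def)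
  next
    case (lo_out T k) then show ?thesis using assms triples_nth[of T q r k] G[of T k] by (auto simp: red_verts_def)
  next
    case (hi_in T k) then show ?thesis using assms triples_nth[of T q r k] G[of T "k + 3"] by (auto simp: red_verts_def)
  next
    case (hi_out T k) then show ?thesis using assms triples_nth[of T q r k] G[of T "k + 3"] by (auto simp: red_verts_def)
  qed (auto simp: red_verts_def)
qed

lemma Suc_mod_neq: "k < 6 \<Longrightarrow> Suc k mod 6 \<noteq> k"
  by presburger

lemma irrefl_red_arcs: "irrefl (red_arcs q r Ts)"
  unfolding irrefl_def
proof (intro allI notI)
  fix v assume "(v, v) \<in> red_arcs q r Ts"
  then show False by cases (use Suc_mod_neq in auto)
qed

lemma acyclic_rank:
  fixes rank :: "'a \<Rightarrow> nat"
  assumes "\<And>u v. (u, v) \<in> R \<Longrightarrow> rank u < rank v" shows "acyclic R"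
proof -
  have "rank u < rank v" if "(u, v) \<in> R\<^sup>+" for u v
    using that by induction (use assms less_trans in blast)+
  then show ?thesis unfolding acyclic_def by blast
qed

lemma acyclic_asym: "acyclic R \<Longrightarrow> (u, v) \<in> R\<^sup>+ \<Longrightarrow> (v, u) \<notin> R\<^sup>+"
  unfolding acyclic_def by (meson trancl_trans)

section \<open>Equivalence of colorings and admissible positions\<close>

text \<open>No arcs join palette vertices, so the coloring does not force an order on them; taking a
  maximum yields a value anyway. A low gadget vertex would close a cycle if \<open>Pal a\<close>
  reached the group, so \<open>a\<close> is not in \<open>S i\<close>; a high one puts
  \<open>Suc a\<close> into \<open>S i\<close>, so the maximum exceeds \<open>a\<close>. In both
  cases the value is not \<open>a\<close>.\<close>

lemma position_of_coloring:
  fixes c :: "vertex \<Rightarrow> bool"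
  assumes Ts: "Ts \<subseteq> triples q r"
    and c: "\<And>b. acyclic {(u, v) \<in> red_arcs q r Ts. c u = b \<and> c v = b}"
  shows "\<exists>pos. (\<forall>i<r. pos i < q) \<and> (\<forall>T\<in>Ts. \<exists>(i, a)\<in>set T. pos i \<noteq> a)"
proof -
  define b where "b = (\<not> c Hub)"
  define R where "R = {(u, v) \<in> red_arcs q r Ts. c u = b \<and> c v = b}"
  have R: "acyclic R" using c[of b] by (simp add: R_def)
  have col: "c x = b" if "(Hub, x) \<in> red_arcs q r Ts" "(x, Hub) \<in> red_arcs q r Ts" for x
  proof (rule ccontr)
    assume "c x \<noteq> b"
    then have "(Hub, x) \<in> {(u, v) \<in> red_arcs q r Ts. c u = c Hub \<and> c v = c Hub}\<^sup>+"
      "(x, Hub) \<in> {(u, v) \<in> red_arcs q r Ts. c u = c Hub \<and> c v = c Hub}\<^sup>+"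
      using that by (auto simp: b_def)
    with acyclic_asym[OF c[of "c Hub"]] show False by blast
  qed
  have colP: "c (Pal a) = b" if "a \<le> q" for a
    using that by (intro col hub_pal pal_hub)
  have colG: "c (Grp i) = b" if "i < r" for i
    using that by (intro col hub_grp grp_hub)
  define S where "S i = {a. a \<le> q \<and> (Pal a, Grp i) \<in> R\<^sup>+}" for i
  define pos where "pos i = Max (S i)" for i
  have S: "finite (S i)" for i by (auto simp: S_def)
  \<comment> \<open>The arc from \<open>Pal 0\<close> makes \<open>S i\<close> nonempty, and below
    the arc to \<open>Pal q\<close> keeps \<open>q\<close> out of it; so \<open>q + 1\<close>
    palette vertices provide \<open>q\<close> values.\<close>
  have S0: "0 \<in> S i" if "i < r" for i
    using that colP[of 0] colG[of i] first[of i] by (auto simp: S_def R_def)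
  have pos: "pos i \<in> S i" "\<And>a. a \<in> S i \<Longrightarrow> a \<le> pos i" if "i < r" for i
    using S S0[OF that] unfolding pos_def by (auto intro: Max_in)
  have "pos i < q" if "i < r" for i
  proof -
    have "(Grp i, Pal q) \<in> R"
      using that colP[of q] colG[of i] last[of i] by (auto simp: R_def)
    then have "(Pal q, Grp i) \<notin> R\<^sup>+" using acyclic_asym[OF R] by blast
    with pos(1)[OF that] show ?thesis by (auto simp: S_def order.order_iff_strict)
  qed
  moreover have "\<exists>(i, a)\<in>set T. pos i \<noteq> a" if T: "T \<in> Ts" for T
  proof -
    have "\<exists>k<6. c (Gad T k) = b"
    proof (rule ccontr)
      let ?R = "{(u, v) \<in> red_arcs q r Ts. c u = (\<not> b) \<and> c v = (\<not> b)}"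
      assume *: "\<not> (\<exists>k<6. c (Gad T k) = b)"
      have e: "(Gad T k, Gad T (Suc k mod 6)) \<in> ?R" if "k < 6" for k
        using that * T by (auto intro: cyc)
      have "(Gad T 0, Gad T k) \<in> ?R\<^sup>+" if "0 < k" "k < 6" for k
        using that
      proof (induction k)
        case (Suc k)
        show ?case
        proof (cases "k = 0")
          case True
          then show ?thesis using e[of 0] by auto
        next
          case False
          then show ?thesis using Suc e[of k] by (auto intro: trancl_into_trancl)
        qed
      qed simp
      from this[of 5] e[of 5] have "(Gad T 0, Gad T 0) \<in> ?R\<^sup>+" by (auto intro: trancl_into_trancl)
      with c[of "\<not> b"] show False by (auto simp: acyclic_def)
    qed
    then obtain k' where k': "k' < 6" "c (Gad T k') = b" by blast
    \<comment> \<open>The vertices \<open>k\<close> and \<open>k + 3\<close> of the cycle act on the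
      same pair \<open>T ! k\<close>.\<close>
    define k where "k = k' mod 3"
    have k: "k < 3" "k' = k \<or> k' = k + 3" using k'(1) unfolding k_def by presburger+
    let ?i = "fst (T ! k)" and ?a = "snd (T ! k)"
    have ia: "?i < r" "?a < q" using triples_nth[of T q r k] T Ts k by auto
    have "pos ?i \<noteq> ?a"
    proof
      assume p: "pos ?i = ?a"
      from k(2) show False
      proof
        assume "k' = k"
        then have "(Grp ?i, Gad T k) \<in> R" "(Gad T k, Pal ?a) \<in> R"
          using k' k T ia colP[of ?a] colG[of ?i] lo_in[of T Ts k q r] lo_out[of T Ts k q r] by (auto simp: R_def)
        then have "(Grp ?i, Pal ?a) \<in> R\<^sup>+" by (rule trancl_into_trancl[OF r_into_trancl])
        moreover have "(Pal ?a, Grp ?i) \<in> R\<^sup>+" using pos(1)[OF ia(1)] p by (simp add: S_def)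
        ultimately show False using acyclic_asym[OF R] by blast
      next
        assume "k' = k + 3"
        then have "(Pal (Suc ?a), Gad T (k + 3)) \<in> R" "(Gad T (k + 3), Grp ?i) \<in> R"
          using k' k T ia colP[of "Suc ?a"] colG[of ?i] hi_in[of T Ts k q r] hi_out[of T Ts k q r] by (auto simp: R_def)
        then have "(Pal (Suc ?a), Grp ?i) \<in> R\<^sup>+" by (rule trancl_into_trancl[OF r_into_trancl])
        with ia have "Suc ?a \<in> S ?i" by (simp add: S_def)
        with pos(2)[OF ia(1)] p show False by fastforce
      qed
    qed
    moreover have "T ! k \<in> set T" using k T Ts by (auto simp: triples_def)
    ultimately show ?thesis by (metis (mono_tags, lifting) case_prod_beta)
  qed
  ultimately show ?thesis by blast
qed

lemma coloring_of_position:
  assumes Ts: "Ts \<subseteq> triples q r" and pos: "\<And>i. i < r \<Longrightarrow> pos i < q"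
    and T: "\<And>T. T \<in> Ts \<Longrightarrow> \<exists>(i, a)\<in>set T. pos i \<noteq> a"
  shows "\<exists>c. \<forall>b::bool. acyclic {(u, v) \<in> red_arcs q r Ts. c u = b \<and> c v = b}"
proof -
  \<comment> \<open>\<open>w\<close> is the one cycle vertex that will join the palette: a low
    vertex if the differing group lies below its forbidden value, the matching high vertex if it
    lies above.\<close>
  have "\<exists>w<6. if w < 3 then pos (fst (T ! w)) < snd (T ! w) else snd (T ! (w - 3)) < pos (fst (T ! (w - 3)))"
    if T': "T \<in> Ts" for T
  proof -
    from T[OF T'] obtain x where "x \<in> set T" "pos (fst x) \<noteq> snd x" by auto
    moreover have "length T = 3" using Ts T' by (auto simp: triples_def)
    ultimately obtain k where k: "k < 3" "pos (fst (T ! k)) \<noteq> snd (T ! k)"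
      by (metis in_set_conv_nth)
    show ?thesis
    proof (cases "pos (fst (T ! k)) < snd (T ! k)")
      case True
      then show ?thesis using k by (intro exI[of _ k]) auto
    next
      case False
      then show ?thesis using k by (intro exI[of _ "k + 3"]) auto
    qed
  qed
  then obtain w where w: "\<And>T. T \<in> Ts \<Longrightarrow> w T < 6"
    "\<And>T. T \<in> Ts \<Longrightarrow> w T < 3 \<Longrightarrow> pos (fst (T ! w T)) < snd (T ! w T)"
    "\<And>T. T \<in> Ts \<Longrightarrow> \<not> w T < 3 \<Longrightarrow> snd (T ! (w T - 3)) < pos (fst (T ! (w T - 3)))"
    by metis
  define c where "c v = (case v of Hub \<Rightarrow> True | Pal _ \<Rightarrow> False | Grp _ \<Rightarrow> False | Gad T k \<Rightarrow> k \<noteq> w T)" for v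
  \<comment> \<open>Steps of 4 leave room between palette vertices: a group comes halfway after the
    palette vertex of its value, a low vertex immediately after its group, and a high vertex
    immediately after \<open>Pal (Suc a)\<close>, whose rank is \<open>4 * a + 4\<close>.\<close>
  define rank0 where "rank0 v = (case v of Hub \<Rightarrow> 0 | Pal a \<Rightarrow> 4 * a | Grp i \<Rightarrow> 4 * pos i + 2
    | Gad T k \<Rightarrow> if k < 3 then 4 * pos (fst (T ! k)) + 3 else 4 * snd (T ! (k - 3)) + 5)" for v
  \<comment> \<open>The distance from the removed vertex \<open>w T\<close> along the cycle; it
    would drop only on the arc back into \<open>w T\<close>. The hub has no arcs to or from gadget
    vertices.\<close>
  define rank1 where "rank1 v = (case v of Gad T k \<Rightarrow> (k + 6 - w T) mod 6 | _ \<Rightarrow> 0)" for v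
  have "acyclic {(u, v) \<in> red_arcs q r Ts. c u = False \<and> c v = False}"
  proof (rule acyclic_rank[of _ rank0])
    fix u v assume "(u, v) \<in> {(u, v) \<in> red_arcs q r Ts. c u = False \<and> c v = False}"
    then have "(u, v) \<in> red_arcs q r Ts" and f: "\<not> c u" "\<not> c v" by auto
    then show "rank0 u < rank0 v"
    proof cases
      case (cyc T k)
      with f Suc_mod_neq[of k] show ?thesis by (simp add: c_def)
    next
      case (last i)
      with pos[of i] show ?thesis by (simp add: rank0_def)
    next
      case (hi_out T k)
      from hi_out f have "w T = k + 3" by (simp add: c_def)
      with hi_out w(3)[of T] show ?thesis by (simp add: rank0_def)
    next
      case (hi_in T k)
      then show ?thesis by (simp add: rank0_def)
    next
      case (lo_out T k)
      from lo_out f have "w T = k" by (simp add: c_def)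
      with lo_out w(2)[of T] show ?thesis by (simp add: rank0_def)
    qed (use f in \<open>auto simp: c_def rank0_def\<close>)
  qed
  moreover have "acyclic {(u, v) \<in> red_arcs q r Ts. c u = True \<and> c v = True}"
  proof (rule acyclic_rank[of _ rank1])
    fix u v assume "(u, v) \<in> {(u, v) \<in> red_arcs q r Ts. c u = True \<and> c v = True}"
    then have "(u, v) \<in> red_arcs q r Ts" and f: "c u" "c v" by auto
    then show "rank1 u < rank1 v"
    proof cases
      case (cyc T k)
      have "\<forall>k\<in>{..<6}. \<forall>w\<in>{..<6}. Suc k mod 6 \<noteq> w \<longrightarrow> (k + 6 - w) mod 6 < (Suc k mod 6 + 6 - w) mod (6::nat)"
        by (simp add: lessThan_nat_numeral lessThan_Suc)
      with cyc f w(1)[of T] show ?thesis by (auto simp: c_def rank1_def)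
    qed (use f in \<open>auto simp: c_def\<close>)
  qed
  ultimately have "acyclic {(u, v) \<in> red_arcs q r Ts. c u = b \<and> c v = b}" for b
    by (cases b) auto
  then show ?thesis by blast
qed

text \<open>Once the core is deleted, the triple names the component. The empty list is a default
  for core vertices, whose labels are never compared.\<close>

definition label :: "vertex \<Rightarrow> (nat \<times> nat) list" where
  "label v = (case v of Gad T k \<Rightarrow> T | _ \<Rightarrow> [])"

definition red_core :: "nat \<Rightarrow> nat \<Rightarrow> vertex set" where
  "red_core q r = insert Hub (Pal ` {..q} \<union> Grp ` {..<r})"

lemma card_red_core_le: "card (red_core q r) \<le> q + r + 2"
proof -
  have "card (Pal ` {..q} \<union> Grp ` {..<r}) \<le> card (Pal ` {..q}) + card (Grp ` {..<r})"
    by (rule card_Un_le)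
  also have "\<dots> \<le> Suc q + r"
    using card_image_le[of "{..q}" Pal] card_image_le[of "{..<r}" Grp] by simp
  finally show ?thesis unfolding red_core_def by (intro card_insert_le_m1) auto
qed

lemma label_red_arcs:
  assumes "Ts \<subseteq> triples q r" "(u, v) \<in> red_arcs q r Ts" "u \<notin> red_core q r" "v \<notin> red_core q r"
  shows "label u = label v"
  using assms(2)
proof cases
  case (cyc T k)
  then show ?thesis by (simp add: label_def)
qed (use assms triples_nth in \<open>force simp: red_core_def\<close>)+

lemma card_label_le: "card {v \<in> red_verts q r Ts - red_core q r. label v = l} \<le> 6"
proof -
  have "{v \<in> red_verts q r Ts - red_core q r. label v = l} \<subseteq> Gad l ` {..<6}"
    by (auto simp: red_verts_def red_core_def label_def)
  then have "card {v \<in> red_verts q r Ts - red_core q r. label v = l} \<le> card (Gad l ` {..<6})"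
    by (rule card_mono[rotated]) auto
  also have "\<dots> \<le> 6" using card_image_le[of "{..<6}" "Gad l"] by simp
  finally show ?thesis .
qed

section \<open>Assignments to blocks of variables and falsified clauses\<close>

text \<open>Variable \<open>x\<close> is the variable at offset \<open>x mod l\<close> of group \<open>x div l\<close>.\<close>

primrec valuations :: "nat \<Rightarrow> literal list list" where
  "valuations 0 = [[]]"
| "valuations (Suc l) = map ((#) (l, True)) (valuations l) @ map ((#) (l, False)) (valuations l)"

lemma length_valuations: "length (valuations l) = 2 ^ l"
  by (induction l) auto

lemma set_valuations: "set (valuations l) = range (\<lambda>h. map (\<lambda>b. (b, h b)) (rev [0..<l]))"
proof (induction l)
  case (Suc l)
  define g where "g h = map (\<lambda>b. (b, h b)) (rev [0..<l])" for h :: "nat \<Rightarrow> bool"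
  have g: "map (\<lambda>b. (b, h b)) (rev [0..<Suc l]) = (l, h l) # g h" for h
    by (simp add: g_def)
  \<comment> \<open>\<open>g\<close> reads its argument only below \<open>l\<close>, so the value at
    \<open>l\<close> can be chosen freely; this merges the two halves of the list into one
    range.\<close>
  have upd: "g (h(l := \<beta>)) = g h" for h \<beta>
    unfolding g_def by (rule map_cong) auto
  have "set (valuations (Suc l)) = (\<Union>\<beta>. (#) (l, \<beta>) ` range g)"
    using Suc unfolding g_def by (simp add: UNIV_bool Un_commute)
  also have "\<dots> = range (\<lambda>h. (l, h l) # g h)"
  proof (intro equalityI subsetI)
    fix v assume "v \<in> (\<Union>\<beta>. (#) (l, \<beta>) ` range g)"
    then obtain \<beta> h where "v = (l, \<beta>) # g h" by blast
    then have "v = (l, (h(l := \<beta>)) l) # g (h(l := \<beta>))" unfolding upd by simp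
    then show "v \<in> range (\<lambda>h. (l, h l) # g h)" by blast
  qed blast
  finally show ?case unfolding g .
qed auto

text \<open>\<open>(i, a) \<in> set T\<close> stands for the assignment of valuation number \<open>a\<close> to group \<open>i\<close>.\<close>

definition refutes :: "nat \<Rightarrow> (nat \<times> nat) list \<Rightarrow> literal \<Rightarrow> bool" where
  "refutes l T = (\<lambda>(x, \<beta>). \<exists>(i, a)\<in>set T. \<exists>(b, \<beta>')\<in>set (valuations l ! a). x = i * l + b \<and> \<beta>' \<noteq> \<beta>)"

text \<open>A triple may give one group two different values. No \<open>pos\<close> agrees with it,
  so excluding it is harmless.\<close>

definition bad_triples :: "nat \<Rightarrow> nat \<Rightarrow> cnf \<Rightarrow> (nat \<times> nat) list set" where
  "bad_triples l r F = {T \<in> triples (2 ^ l) r. \<exists>C\<in>set F. \<forall>L\<in>set C. refutes l T L}"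

text \<open>Three literals lie in at most three groups, so an assignment violates a clause exactly
  when some triple of its own group values refutes all literals of the clause.\<close>

lemma satisfiable_iff_positions:
  assumes F: "is_3cnf n F" and l: "l > 0" and r: "n < r * l"
  shows "satisfiable F \<longleftrightarrow>
    (\<exists>pos. (\<forall>i<r. pos i < 2 ^ l) \<and> (\<forall>T\<in>bad_triples l r F. \<exists>(i, a)\<in>set T. pos i \<noteq> a))"
proof
  assume "satisfiable F"
  then obtain \<alpha> where \<alpha>: "\<forall>C\<in>set F. \<exists>(x, \<beta>)\<in>set C. \<alpha> x = \<beta>" by (auto simp: satisfiable_def)
  have "\<exists>a<2 ^ l. valuations l ! a = map (\<lambda>b. (b, \<alpha> (i * l + b))) (rev [0..<l])" for i
  proof -
    have "map (\<lambda>b. (b, \<alpha> (i * l + b))) (rev [0..<l]) \<in> set (valuations l)"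
      by (auto simp: set_valuations)
    then show ?thesis by (metis in_set_conv_nth length_valuations)
  qed
  then obtain pos where pos: "\<And>i. pos i < 2 ^ l"
    "\<And>i. valuations l ! pos i = map (\<lambda>b. (b, \<alpha> (i * l + b))) (rev [0..<l])" by metis
  have "\<exists>(i, a)\<in>set T. pos i \<noteq> a" if T: "T \<in> bad_triples l r F" for T
  proof (rule ccontr)
    assume *: "\<not> (\<exists>(i, a)\<in>set T. pos i \<noteq> a)"
    from T obtain C where C: "C \<in> set F" "\<forall>L\<in>set C. refutes l T L" by (auto simp: bad_triples_def)
    with \<alpha> obtain x where x: "(x, \<alpha> x) \<in> set C" by auto
    with C have "refutes l T (x, \<alpha> x)" by blast
    then obtain i a b \<beta> where "(i, a) \<in> set T" "(b, \<beta>) \<in> set (valuations l ! a)" "x = i * l + b" "\<beta> \<noteq> \<alpha> x"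
      by (auto simp: refutes_def)
    with * pos(2)[of i] show False by auto
  qed
  with pos(1) show "\<exists>pos. (\<forall>i<r. pos i < 2 ^ l) \<and> (\<forall>T\<in>bad_triples l r F. \<exists>(i, a)\<in>set T. pos i \<noteq> a)" by blast
next
  assume "\<exists>pos. (\<forall>i<r. pos i < 2 ^ l) \<and> (\<forall>T\<in>bad_triples l r F. \<exists>(i, a)\<in>set T. pos i \<noteq> a)"
  then obtain pos where pos: "\<And>i. i < r \<Longrightarrow> pos i < 2 ^ l"
    and bad: "\<And>T. T \<in> bad_triples l r F \<Longrightarrow> \<exists>(i, a)\<in>set T. pos i \<noteq> a" by blast
  have "\<exists>h. valuations l ! a = map (\<lambda>b. (b, h b)) (rev [0..<l])" if "a < 2 ^ l" for a
    using nth_mem[of a "valuations l"] that by (auto simp: length_valuations set_valuations)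
  then obtain h where h: "\<And>a. a < 2 ^ l \<Longrightarrow> valuations l ! a = map (\<lambda>b. (b, h a b)) (rev [0..<l])" by metis
  define \<alpha> where "\<alpha> x = h (pos (x div l)) (x mod l)" for x
  have "\<exists>(x, \<beta>)\<in>set C. \<alpha> x = \<beta>" if C: "C \<in> set F" for C
  proof (rule ccontr)
    assume *: "\<not> (\<exists>(x, \<beta>)\<in>set C. \<alpha> x = \<beta>)"
    \<comment> \<open>The groups of the literals of \<open>C\<close> with their current values,
      padded with group 0 to length 3.\<close>
    define T where "T = map (\<lambda>i. (i, pos i)) (map (\<lambda>(x, \<beta>). x div l) C @ replicate (3 - length C) 0)"
    have C3: "length C \<le> 3" "\<And>x \<beta>. (x, \<beta>) \<in> set C \<Longrightarrow> x < n" using F C by (auto simp: is_3cnf_def)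
    have div: "x div l < r" if "x < n" for x
      using that r l by (simp add: div_less_iff_less_mult)
    \<comment> \<open>The strict bound on \<open>n\<close> makes group 0 exist even without
      variables, as the padding requires.\<close>
    have r0: "0 < r" using r by (cases r) auto
    have T1: "T \<in> triples (2 ^ l) r"
      using C3 div r0 pos by (fastforce simp: triples_def T_def split: prod.splits)
    have "refutes l T (x, \<beta>)" if x: "(x, \<beta>) \<in> set C" for x \<beta>
    proof -
      from x * have "\<alpha> x \<noteq> \<beta>" by auto
      moreover have "(x div l, pos (x div l)) \<in> set T" using x by (force simp: T_def)
      moreover have "(x mod l, \<alpha> x) \<in> set (valuations l ! pos (x div l))"
        using h[OF pos[OF div[OF C3(2)[OF x]]]] l by (auto simp: \<alpha>_def)
      moreover have "x = (x div l) * l + x mod l" by simp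
      ultimately show ?thesis unfolding refutes_def by blast
    qed
    then have "\<forall>L\<in>set C. refutes l T L" by (metis surj_pair)
    with T1 C have "T \<in> bad_triples l r F" by (auto simp: bad_triples_def)
    from bad[OF this] show False by (auto simp: T_def)
  qed
  then show "satisfiable F" by (auto simp: satisfiable_def)
qed

section \<open>The program that computes the graph\<close>

lemma dlist_enc_list [simp]: "dlist (enc_list f xs) = map f xs" by (induction xs) auto
lemma mk_map_eq [simp]: "mk (map f xs) = enc_list f xs" by (induction xs) auto
lemma length_dlist_enc_nat [simp]: "length (dlist (enc_nat n)) = n" by (induction n) auto
lemma enc_nat_inj [simp]: "enc_nat m = enc_nat n \<longleftrightarrow> m = n" by (metis length_dlist_enc_nat)
lemma enc_bool_inj [simp]: "enc_bool a = enc_bool b \<longleftrightarrow> a = b" by (cases a; cases b) auto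
lemma size_enc_nat: "size (enc_nat n) = n" by (induction n) auto
lemma size_enc_list: "size (enc_list f xs) = (\<Sum>x\<leftarrow>xs. size (f x) + 1)" by (induction xs) auto
lemma enc_nat_conv: "enc_nat n = mk (replicate n Leaf)" by (induction n) auto
lemma dlist_enc_nat: "dlist (enc_nat n) = replicate n Leaf" by (simp add: enc_nat_conv)

section \<open>Unary arithmetic on lists\<close>

text \<open>A number is a list of which only the length matters: addition is append, multiplication
  is bind, comparison is drop. Since instances are encoded in unary, polynomial size is
  preserved.\<close>

definition unary :: "data \<Rightarrow> data" where "unary d = mk (map (\<lambda>_. Leaf) (dlist d))"
definition append_data :: "data \<Rightarrow> data \<Rightarrow> data" where "append_data a b = mk (dlist a @ dlist b)"
definition bind_data :: "(data \<Rightarrow> data) \<Rightarrow> data \<Rightarrow> data" where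
  "bind_data f d = mk (concat (map dlist (dlist (mk (map f (dlist d))))))"
definition times_data :: "data \<Rightarrow> data \<Rightarrow> data" where "times_data a b = bind_data (\<lambda>_. b) a"
definition drop_data :: "data \<Rightarrow> data \<Rightarrow> data" where "drop_data a b = fold (\<lambda>_. right) (dlist a) b"
definition le_data :: "data \<Rightarrow> data \<Rightarrow> bool" where "le_data a b \<longleftrightarrow> drop_data b a = Leaf"
text \<open>The length of the list built so far is the next number, so the accumulator serves as its
  own counter.\<close>

definition down_data :: "data \<Rightarrow> data" where "down_data d = fold (\<lambda>_ a. Node (unary a) a) (dlist d) Leaf"

lemma ptime_unary: "ptime f \<Longrightarrow> ptime (\<lambda>x. unary (f x))"
  unfolding unary_def by (intro ptime_map ptime_basic)

lemma ptime_append_data: "ptime f \<Longrightarrow> ptime g \<Longrightarrow> ptime (\<lambda>x. append_data (f x) (g x))"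
  unfolding append_data_def by (rule ptime_append)

lemma ptime_bind_data:
  "ptime (\<lambda>p. f (left p) (right p)) \<Longrightarrow> ptime l \<Longrightarrow> ptime (\<lambda>x. bind_data (f x) (l x))"
  unfolding bind_data_def by (intro ptime_concat ptime_map)

lemma ptime_times_data: "ptime f \<Longrightarrow> ptime g \<Longrightarrow> ptime (\<lambda>x. times_data (f x) (g x))"
  unfolding times_data_def by (rule ptime_bind_data[OF ptime_comp[OF _ ptime_left[OF ptime_id]]])

lemma ptime_drop_data: "ptime f \<Longrightarrow> ptime g \<Longrightarrow> ptime (\<lambda>x. drop_data (f x) (g x))"
  unfolding drop_data_def
  by (rule ptime_fold_additive[where B = "\<lambda>_. 0"])
    (assumption | intro ptime_right ptime_id pbound_const | simp add: size_right)+

lemma pdec_le_data: "ptime f \<Longrightarrow> ptime g \<Longrightarrow> pdec (\<lambda>x. le_data (f x) (g x))"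
  unfolding le_data_def by (intro pdec_Leaf ptime_drop_data)

lemma unary_eq: "unary d = enc_nat (length (dlist d))"
  by (simp add: unary_def enc_nat_conv map_replicate_const del: mk_map_eq)

lemma append_data_enc_list [simp]: "append_data (enc_list f xs) (enc_list f ys) = enc_list f (xs @ ys)"
  by (simp add: append_data_def del: map_append flip: map_append)

lemma append_data_enc_nat [simp]: "append_data (enc_nat a) (enc_nat b) = enc_nat (a + b)"
  by (simp add: append_data_def dlist_enc_nat flip: replicate_add) (simp add: enc_nat_conv)

lemma length_append_data [simp]: "length (dlist (append_data a b)) = length (dlist a) + length (dlist b)"
  by (simp add: append_data_def)

lemma dlist_bind_data [simp]: "dlist (bind_data f d) = concat (map (\<lambda>e. dlist (f e)) (dlist d))"
  by (simp add: bind_data_def o_def del: mk_map_eq)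

lemma bind_data_enc_list:
  assumes "\<And>e. e \<in> set xs \<Longrightarrow> f (g e) = enc_list h (k e)"
  shows "bind_data f (enc_list g xs) = enc_list h (concat (map k xs))"
proof -
  have "dlist (bind_data f (enc_list g xs)) = map h (concat (map k xs))"
    using assms by (simp add: map_concat o_def cong: map_cong)
  then show ?thesis by (metis mk_dlist mk_map_eq)
qed

lemma length_times_data [simp]: "length (dlist (times_data a b)) = length (dlist a) * length (dlist b)"
  by (simp add: times_data_def length_concat o_def sum_list_triv)

lemma times_data_enc_nat [simp]: "times_data (enc_nat a) (enc_nat b) = enc_nat (a * b)"
proof -
  have "concat (replicate a (replicate b Leaf)) = replicate (a * b) Leaf"
    by (induction a) (auto simp: replicate_add)
  then have "dlist (times_data (enc_nat a) (enc_nat b)) = dlist (enc_nat (a * b))"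
    by (simp add: times_data_def dlist_enc_nat)
  then show ?thesis by (metis mk_dlist)
qed

lemma dlist_right [simp]: "dlist (right a) = tl (dlist a)" by (cases a) auto
lemma left_eq_hd: "dlist a \<noteq> [] \<Longrightarrow> left a = hd (dlist a)" by (cases a) auto

lemma drop_data_eq: "drop_data a b = mk (drop (length (dlist a)) (dlist b))"
proof -
  have "dlist (fold (\<lambda>_. right) xs b) = drop (length xs) (dlist b)" for xs :: "data list"
    by (induction xs arbitrary: b) (auto simp: drop_Suc)
  then show ?thesis unfolding drop_data_def by (metis mk_dlist)
qed

lemma mk_eq_Leaf [simp]: "mk xs = Leaf \<longleftrightarrow> xs = []" by (cases xs) auto

lemma le_data_iff: "le_data a b \<longleftrightarrow> length (dlist a) \<le> length (dlist b)"
  by (simp add: le_data_def drop_data_eq)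

lemma down_data_eq: "down_data d = enc_list enc_nat (rev [0..<length (dlist d)])"
proof -
  have "fold (\<lambda>_ a. Node (unary a) a) xs (enc_list enc_nat (rev [0..<m])) = enc_list enc_nat (rev [0..<length xs + m])"
    for xs :: "data list" and m
  proof (induction xs arbitrary: m)
    case (Cons x xs)
    from Cons[of "Suc m"] show ?case by (simp add: unary_eq)
  qed simp
  from this[of _ 0] show ?thesis by (simp add: down_data_def)
qed

text \<open>A step adds the length of the accumulator, which is not bounded a priori in terms of
  \<open>x\<close>. The closed form of the accumulator after each prefix gives a quadratic bound
  instead.\<close>

lemma ptime_down_data:
  assumes "ptime f" shows "ptime (\<lambda>x. down_data (f x))"
  unfolding down_data_def
proof (rule ptime_fold[OF assms ptime_const])
  show "ptime (\<lambda>p. Node (unary (right p)) (right p))" by (intro ptime_unary ptime_basic)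
  show "pbound (\<lambda>x. size (f x) * (size (f x) + 1))" by (intro pbound_intros ptime_size assms)
  fix x j
  let ?m = "length (take j (dlist (f x)))"
  have m: "?m \<le> size (f x)" using length_dlist_le[of "f x"] by simp
  have "size (fold (\<lambda>_ a. Node (unary a) a) (take j (dlist (f x))) Leaf) = size (enc_list enc_nat (rev [0..<?m]))"
    using down_data_eq[of "mk (take j (dlist (f x)))"] by (simp add: down_data_def)
  also have "\<dots> = (\<Sum>i\<leftarrow>rev [0..<?m]. i + 1)"
    by (simp only: size_enc_list size_enc_nat)
  also have "\<dots> \<le> (\<Sum>i\<leftarrow>rev [0..<?m]. size (f x) + 1)"
    by (rule sum_list_mono) (use m in auto)
  also have "\<dots> = ?m * (size (f x) + 1)" by (simp add: sum_list_triv)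
  also have "\<dots> \<le> size (f x) * (size (f x) + 1)" using m by (rule mult_right_mono) simp
  finally show "size (fold (\<lambda>_ a. Node (unary a) a) (take j (dlist (f x))) Leaf) \<le> size (f x) * (size (f x) + 1)" .
qed

lemmas ptime_rules = ptime_basic ptime_map ptime_filter ptime_unary ptime_append_data ptime_bind_data
  ptime_times_data ptime_drop_data ptime_down_data pdec_le_data pdec_not pdec_conj pdec_eq pdec_bex ptime_if

section \<open>Choice of the group size and enumeration of the values of a group\<close>

definition enc_valuations :: "nat \<Rightarrow> data" where
  "enc_valuations l = enc_list (enc_list enc_literal) (valuations l)"

text \<open>The index of the new variable is not stored anywhere: it is the length of the first
  valuation in the list.\<close>

definition extend_valuations :: "data \<Rightarrow> data" where
  "extend_valuations s = append_data
     (mk (map (Node (Node (unary (left s)) (enc_bool True))) (dlist s)))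
     (mk (map (Node (Node (unary (left s)) (enc_bool False))) (dlist s)))"

text \<open>Squaring the length of the list compares \<open>4 ^ l\<close> with \<open>N\<close>, so
  the logarithm is found without computing one. Once \<open>4 ^ l\<close> exceeds \<open>N\<close>
  the step is idle, and surplus rounds do no harm.\<close>

definition valuations_step :: "data \<Rightarrow> data \<Rightarrow> data" where
  "valuations_step N s = (if le_data (times_data s s) N then extend_valuations s else s)"

text \<open>Its length is the number of variables plus the number of clauses plus 1; the clauses can
  be appended as they are, because only the length is read.\<close>

definition size_data :: "data \<Rightarrow> data" where
  "size_data x = Node Leaf (append_data (left x) (right x))"

definition valuations_data :: "data \<Rightarrow> data" where
  "valuations_data x = fold (\<lambda>_. valuations_step (size_data x)) (dlist (size_data x)) (enc_valuations 0)"

lemma valuations_ne: "valuations l \<noteq> []"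
  using length_valuations[of l] by (metis list.size(3) power_not_zero zero_neq_numeral)

lemma length_hd_valuations: "length (hd (valuations l)) = l"
  using set_valuations[of l] hd_in_set[OF valuations_ne[of l]] by auto

lemma left_enc_valuations: "left (enc_valuations l) = enc_list enc_literal (hd (valuations l))"
  by (simp add: enc_valuations_def left_eq_hd valuations_ne hd_map)

lemma extend_valuations: "extend_valuations (enc_valuations l) = enc_valuations (Suc l)"
proof -
  have *: "mk (map (Node (Node (unary (left (enc_valuations l))) (enc_bool b))) (dlist (enc_valuations l))) =
     enc_list (enc_list enc_literal) (map ((#) (l, b)) (valuations l))" for b
  proof -
    have "map (Node (Node (unary (left (enc_valuations l))) (enc_bool b))) (dlist (enc_valuations l)) =
       map (enc_list enc_literal) (map ((#) (l, b)) (valuations l))"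
      by (simp add: left_enc_valuations unary_eq length_hd_valuations)
        (simp add: enc_valuations_def enc_literal_def)
    then show ?thesis by (simp only: mk_map_eq)
  qed
  show ?thesis unfolding extend_valuations_def * by (simp add: enc_valuations_def)
qed

lemma length_enc_valuations: "length (dlist (enc_valuations l)) = 2 ^ l"
  by (simp add: enc_valuations_def length_valuations)

lemma valuations_step:
  "valuations_step N (enc_valuations l) = enc_valuations (if 4 ^ l \<le> length (dlist N) then Suc l else l)"
  by (simp add: valuations_step_def extend_valuations le_data_iff length_enc_valuations
    flip: power_mult_distrib)

lemma valuations_iterate:
  "\<exists>l. fold (\<lambda>_. valuations_step N) xs (enc_valuations 0) = enc_valuations l \<and>
     (l = 0 \<or> 4 ^ (l - 1) \<le> length (dlist N)) \<and> (l = length xs \<or> length (dlist N) < 4 ^ l)"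
proof (induction xs rule: rev_induct)
  case (snoc x xs)
  then obtain l where l: "fold (\<lambda>_. valuations_step N) xs (enc_valuations 0) = enc_valuations l"
     "l = 0 \<or> 4 ^ (l - 1) \<le> length (dlist N)" "l = length xs \<or> length (dlist N) < 4 ^ l" by blast
  then show ?case
    by (intro exI[of _ "if 4 ^ l \<le> length (dlist N) then Suc l else l"]) (auto simp: valuations_step)
qed (intro exI[of _ 0], simp)

lemma size_enc_valuations_le: "size (enc_valuations l) \<le> 2 ^ l * (2 ^ l * (2 ^ l + 3) + 1)"
proof -
  have l: "l \<le> 2 ^ l" by (simp add: less_imp_le)
  have lit: "size (enc_literal L) + 1 \<le> 2 ^ l + 3" if "fst L < l" for L
  proof -
    have "size (enc_bool (snd L)) \<le> 1" by (cases "snd L") auto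
    moreover have "size (enc_literal L) = fst L + size (enc_bool (snd L)) + 1"
      by (simp add: enc_literal_def size_enc_nat)
    ultimately show ?thesis using that l by linarith
  qed
  have val: "size (enc_list enc_literal v) + 1 \<le> 2 ^ l * (2 ^ l + 3) + 1" if "v \<in> set (valuations l)" for v
  proof -
    have v: "\<And>L. L \<in> set v \<Longrightarrow> fst L < l" "length v = l" using that by (auto simp: set_valuations)
    have "size (enc_list enc_literal v) = (\<Sum>L\<leftarrow>v. size (enc_literal L) + 1)"
      by (rule size_enc_list)
    also have "\<dots> \<le> (\<Sum>L\<leftarrow>v. 2 ^ l + 3)" by (rule sum_list_mono) (use lit v in auto)
    also have "\<dots> \<le> 2 ^ l * (2 ^ l + 3)" unfolding sum_list_triv v(2) using l by (simp add: mult_right_mono)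
    finally show ?thesis by simp
  qed
  have "size (enc_valuations l) = (\<Sum>v\<leftarrow>valuations l. size (enc_list enc_literal v) + 1)"
    unfolding enc_valuations_def by (rule size_enc_list)
  also have "\<dots> \<le> (\<Sum>v\<leftarrow>valuations l. 2 ^ l * (2 ^ l + 3) + 1)" by (rule sum_list_mono) (use val in auto)
  finally show ?thesis by (simp add: sum_list_triv length_valuations)
qed

lemma ptime_size_data: "ptime f \<Longrightarrow> ptime (\<lambda>x. size_data (f x))"
  unfolding size_data_def by (intro ptime_rules)

text \<open>A step can double the accumulator, which rules out the additive fold rule. The guard in
  the step keeps \<open>2 ^ l\<close> linear in \<open>?N x\<close>, and the size of the list is
  polynomial in \<open>2 ^ l\<close>.\<close>

lemma ptime_valuations_data_fun: "ptime valuations_data"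
  unfolding valuations_data_def[abs_def]
proof (rule ptime_fold)
  let ?N = "\<lambda>x. length (dlist (size_data x))"
  let ?B = "\<lambda>x. 2 * ?N x + 1"
  show "ptime size_data" "ptime (\<lambda>_. enc_valuations 0)"
    by (intro ptime_size_data ptime_rules)+
  show "ptime (\<lambda>p. valuations_step (size_data (left (left p))) (right p))"
    unfolding valuations_step_def extend_valuations_def
    by (intro ptime_rules ptime_size_data)
  show "pbound (\<lambda>x. ?B x * (?B x * (?B x + 3) + 1))"
    by (intro pbound_intros pbound_length ptime_size_data ptime_rules)
  fix x j
  obtain l where l: "fold (\<lambda>_. valuations_step (size_data x)) (take j (dlist (size_data x))) (enc_valuations 0) = enc_valuations l"
     "l = 0 \<or> 4 ^ (l - 1) \<le> ?N x" using valuations_iterate by blast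
  have "2 ^ l \<le> ?B x"
  proof (cases l)
    case (Suc k)
    have "(2::nat) ^ k \<le> 4 ^ k" by (rule power_mono) auto
    then show ?thesis using l Suc by simp
  qed simp
  then have "2 ^ l * (2 ^ l * (2 ^ l + 3) + 1) \<le> ?B x * (?B x * (?B x + 3) + 1)"
    by (intro mult_le_mono add_le_mono) auto
  then show "size (fold (\<lambda>_. valuations_step (size_data x)) (take j (dlist (size_data x))) (enc_valuations 0))
      \<le> ?B x * (?B x * (?B x + 3) + 1)"
    unfolding l(1) using size_enc_valuations_le[of l] by linarith
qed

lemmas ptime_valuations_data = ptime_comp[OF ptime_valuations_data_fun]

lemma valuations_data_enc_cnf:
  obtains l where "valuations_data (enc_cnf n F) = enc_valuations l" "l > 0"
    "4 ^ (l - 1) \<le> n + length F + 1" "n + length F + 1 < 4 ^ l"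
proof -
  have len: "length (dlist (size_data (enc_cnf n F))) = n + length F + 1"
    by (simp add: size_data_def enc_cnf_def)
  obtain l where l: "valuations_data (enc_cnf n F) = enc_valuations l"
    "l = 0 \<or> 4 ^ (l - 1) \<le> n + length F + 1" "l = n + length F + 1 \<or> n + length F + 1 < 4 ^ l"
    using valuations_iterate[of "size_data (enc_cnf n F)" "dlist (size_data (enc_cnf n F))"]
    unfolding valuations_data_def len by blast
  \<comment> \<open>As many rounds as the size are enough: even if every round extended the list,
    \<open>4 ^ l\<close> would exceed the size at the end.\<close>
  have "m < 4 ^ m" for m :: nat using less_exp[of m] power_mono[of 2 "4::nat" m] by linarith
  with l(3) have l4: "n + length F + 1 < 4 ^ l" by metis
  \<comment> \<open>The summand 1 in the size pays off here: \<open>4 ^ 0\<close> does not exceed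
    it, so \<open>l\<close> can serve as a divisor.\<close>
  have "l > 0"
  proof (rule ccontr)
    assume "\<not> l > 0"
    with l4 show False by simp
  qed
  with l l4 show thesis by (intro that[of l]) auto
qed

section \<open>Vertices, arcs and adjacency matrix as data\<close>

text \<open>Division by search: the \<open>i\<close> with \<open>i * l \<le> n\<close> are the
  numbers up to \<open>n div l\<close>.\<close>

definition groups_data :: "data \<Rightarrow> data" where
  "groups_data x = mk (filter (\<lambda>i. le_data (times_data i (unary (left (valuations_data x)))) (left x))
     (dlist (down_data (Node Leaf (left x)))))"

definition pairs_data :: "data \<Rightarrow> data" where
  "pairs_data x = bind_data (\<lambda>i. mk (map (Node i) (dlist (down_data (valuations_data x))))) (groups_data x)"

definition cons_data :: "data \<Rightarrow> data \<Rightarrow> data" where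
  "cons_data ps ls = bind_data (\<lambda>p. mk (map (Node p) (dlist ls))) ps"

definition refutes_data :: "data \<Rightarrow> data \<Rightarrow> data \<Rightarrow> bool" where
  "refutes_data V T L \<longleftrightarrow> (\<exists>p\<in>set (dlist T). \<exists>B\<in>set (dlist (left (drop_data (right p) V))).
     left L = append_data (times_data (left p) (unary (left V))) (left B) \<and> right B \<noteq> right L)"

text \<open>The inner universal quantifier is written as a negated existential one to match the
  closure rules. \<open>Node Leaf Leaf\<close> is the list whose only entry is the empty list, from
  which the triples are built.\<close>

definition bad_data :: "data \<Rightarrow> data" where
  "bad_data x = (let ps = pairs_data x in
     mk (filter (\<lambda>T. \<exists>C\<in>set (dlist (right x)). \<not> (\<exists>L\<in>set (dlist C). \<not> refutes_data (valuations_data x) T L))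
       (dlist (cons_data ps (cons_data ps (cons_data ps (Node Leaf Leaf)))))))"

text \<open>Unary tags separate the kinds of vertices and the six places on a cycle. The hub is
  \<open>Leaf\<close>, which differs from every tagged pair.\<close>

abbreviation "pal_data \<equiv> Node (enc_nat 0)"
abbreviation "grp_data \<equiv> Node (enc_nat 1)"
abbreviation "gad_data k \<equiv> Node (enc_nat (k + 2))"

definition verts_data :: "data \<Rightarrow> data" where
  "verts_data x = append_data (Node Leaf Leaf)
     (append_data (mk (map pal_data (dlist (down_data (Node Leaf (valuations_data x))))))
     (append_data (mk (map grp_data (dlist (groups_data x))))
       (bind_data (\<lambda>T. mk [gad_data 0 T, gad_data 1 T, gad_data 2 T, gad_data 3 T, gad_data 4 T, gad_data 5 T]) (bad_data x))))"

definition gadget_arcs_data :: "data \<Rightarrow> data" where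
  "gadget_arcs_data T = (let p = left T; p' = left (right T); p'' = left (right (right T)) in mk
    [Node (gad_data 0 T) (gad_data 1 T), Node (gad_data 1 T) (gad_data 2 T), Node (gad_data 2 T) (gad_data 3 T),
     Node (gad_data 3 T) (gad_data 4 T), Node (gad_data 4 T) (gad_data 5 T), Node (gad_data 5 T) (gad_data 0 T),
     Node (grp_data (left p)) (gad_data 0 T), Node (gad_data 0 T) (pal_data (right p)),
     Node (grp_data (left p')) (gad_data 1 T), Node (gad_data 1 T) (pal_data (right p')),
     Node (grp_data (left p'')) (gad_data 2 T), Node (gad_data 2 T) (pal_data (right p'')),
     Node (pal_data (Node Leaf (right p))) (gad_data 3 T), Node (gad_data 3 T) (grp_data (left p)),
     Node (pal_data (Node Leaf (right p'))) (gad_data 4 T), Node (gad_data 4 T) (grp_data (left p')),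
     Node (pal_data (Node Leaf (right p''))) (gad_data 5 T), Node (gad_data 5 T) (grp_data (left p''))])"

text \<open>As a vertex, \<open>Leaf\<close> is the hub. \<open>pal_data Leaf\<close> is the first
  palette vertex, and \<open>unary\<close> of the list of valuations is \<open>2 ^ l\<close>, the
  index of the last one.\<close>

definition arcs_data :: "data \<Rightarrow> data" where
  "arcs_data x = append_data
     (bind_data (\<lambda>a. mk [Node Leaf (pal_data a), Node (pal_data a) Leaf]) (down_data (Node Leaf (valuations_data x))))
     (append_data
       (bind_data (\<lambda>i. mk [Node Leaf (grp_data i), Node (grp_data i) Leaf, Node (pal_data Leaf) (grp_data i),
          Node (grp_data i) (pal_data (unary (valuations_data x)))]) (groups_data x))
       (bind_data gadget_arcs_data (bad_data x)))"

definition reduction :: "data \<Rightarrow> data" where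
  "reduction x = mk (map (\<lambda>u. mk (map (\<lambda>v. enc_bool (\<exists>a\<in>set (dlist (arcs_data x)). a = Node u v))
     (dlist (verts_data x)))) (dlist (verts_data x)))"

lemma ptime_groups_data_fun: "ptime groups_data"
  unfolding groups_data_def[abs_def] by (intro ptime_rules ptime_valuations_data)
lemmas ptime_groups_data = ptime_comp[OF ptime_groups_data_fun]

lemma ptime_pairs_data_fun: "ptime pairs_data"
  unfolding pairs_data_def[abs_def] by (intro ptime_rules ptime_valuations_data ptime_groups_data)
lemmas ptime_pairs_data = ptime_comp[OF ptime_pairs_data_fun]

lemma ptime_cons_data_fun: "ptime (\<lambda>p. cons_data (left p) (right p))"
  unfolding cons_data_def[abs_def] by (intro ptime_rules)
lemmas ptime_cons_data = ptime_comp2[OF ptime_cons_data_fun]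

lemma ptime_bad_data_fun: "ptime bad_data"
  unfolding bad_data_def[abs_def] Let_def refutes_data_def
  by (intro ptime_rules ptime_valuations_data ptime_cons_data ptime_pairs_data)
lemmas ptime_bad_data = ptime_comp[OF ptime_bad_data_fun]

lemma ptime_verts_data_fun: "ptime verts_data"
  unfolding verts_data_def[abs_def] enc_list.simps
  by (intro ptime_rules ptime_valuations_data ptime_groups_data ptime_bad_data)
lemmas ptime_verts_data = ptime_comp[OF ptime_verts_data_fun]

lemma ptime_gadget_arcs_data_fun: "ptime gadget_arcs_data"
  unfolding gadget_arcs_data_def[abs_def] enc_list.simps Let_def
  by (intro ptime_rules)
lemmas ptime_gadget_arcs_data = ptime_comp[OF ptime_gadget_arcs_data_fun]

lemma ptime_arcs_data_fun: "ptime arcs_data"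
  unfolding arcs_data_def[abs_def] enc_list.simps
  by (intro ptime_rules ptime_valuations_data ptime_groups_data ptime_bad_data ptime_gadget_arcs_data)
lemmas ptime_arcs_data = ptime_comp[OF ptime_arcs_data_fun]

lemma ptime_reduction: "ptime reduction"
  unfolding reduction_def[abs_def]
  by (intro ptime_rules ptime_arcs_data ptime_verts_data)

section \<open>Correctness of the program\<close>

definition enc_pair :: "nat \<times> nat \<Rightarrow> data" where
  "enc_pair p = Node (enc_nat (fst p)) (enc_nat (snd p))"

definition enc_vertex :: "vertex \<Rightarrow> data" where
  "enc_vertex v = (case v of Hub \<Rightarrow> Leaf | Pal a \<Rightarrow> pal_data (enc_nat a) | Grp i \<Rightarrow> grp_data (enc_nat i)
     | Gad T k \<Rightarrow> gad_data k (enc_list enc_pair T))"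

lemma enc_list_inj: "inj f \<Longrightarrow> enc_list f xs = enc_list f ys \<longleftrightarrow> xs = ys"
  by (metis dlist_enc_list inj_map_eq_map)

text \<open>The adjacency test compares codes; injectivity turns this into equality of
  vertices.\<close>

lemma inj_enc_vertex: "inj enc_vertex"
proof (rule injI)
  have "inj enc_pair" by (auto simp: inj_def enc_pair_def)
  note [simp] = enc_list_inj[OF this]
  fix u v assume "enc_vertex u = enc_vertex v"
  then show "u = v"
    by (cases u; cases v) (auto simp: enc_vertex_def simp del: enc_nat.simps)
qed

definition enc_arc :: "vertex \<times> vertex \<Rightarrow> data" where
  "enc_arc e = Node (enc_vertex (fst e)) (enc_vertex (snd e))"

lemma inj_enc_arc: "inj enc_arc"
  using inj_enc_vertex by (auto simp: inj_def enc_arc_def)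

text \<open>This and the following lists mediate between program and graph: they keep the order in
  which the program enumerates, while their sets are the vertices and arcs of the
  construction.\<close>

definition group_list :: "nat \<Rightarrow> nat \<Rightarrow> nat list" where
  "group_list n l = filter (\<lambda>i. i * l \<le> n) (rev [0..<Suc n])"

definition triple_list :: "nat \<Rightarrow> nat \<Rightarrow> (nat \<times> nat) list list" where
  "triple_list n l = (let ps = List.product (group_list n l) (rev [0..<2 ^ l]) in product_lists [ps, ps, ps])"

definition bad_list :: "nat \<Rightarrow> nat \<Rightarrow> cnf \<Rightarrow> (nat \<times> nat) list list" where
  "bad_list n l F = filter (\<lambda>T. \<exists>C\<in>set F. \<forall>L\<in>set C. refutes l T L) (triple_list n l)"

definition vertex_list :: "nat \<Rightarrow> nat \<Rightarrow> cnf \<Rightarrow> vertex list" where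
  "vertex_list n l F = [Hub] @ map Pal (rev [0..<Suc (2 ^ l)]) @ map Grp (group_list n l) @
     concat (map (\<lambda>T. [Gad T 0, Gad T 1, Gad T 2, Gad T 3, Gad T 4, Gad T 5]) (bad_list n l F))"

definition gadget_arcs :: "(nat \<times> nat) list \<Rightarrow> (vertex \<times> vertex) list" where
  "gadget_arcs T =
    [(Gad T 0, Gad T 1), (Gad T 1, Gad T 2), (Gad T 2, Gad T 3), (Gad T 3, Gad T 4), (Gad T 4, Gad T 5), (Gad T 5, Gad T 0),
     (Grp (fst (T ! 0)), Gad T 0), (Gad T 0, Pal (snd (T ! 0))),
     (Grp (fst (T ! 1)), Gad T 1), (Gad T 1, Pal (snd (T ! 1))),
     (Grp (fst (T ! 2)), Gad T 2), (Gad T 2, Pal (snd (T ! 2))),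
     (Pal (Suc (snd (T ! 0))), Gad T 3), (Gad T 3, Grp (fst (T ! 0))),
     (Pal (Suc (snd (T ! 1))), Gad T 4), (Gad T 4, Grp (fst (T ! 1))),
     (Pal (Suc (snd (T ! 2))), Gad T 5), (Gad T 5, Grp (fst (T ! 2)))]"

definition arc_list :: "nat \<Rightarrow> nat \<Rightarrow> cnf \<Rightarrow> (vertex \<times> vertex) list" where
  "arc_list n l F =
     concat (map (\<lambda>a. [(Hub, Pal a), (Pal a, Hub)]) (rev [0..<Suc (2 ^ l)])) @
     concat (map (\<lambda>i. [(Hub, Grp i), (Grp i, Hub), (Pal 0, Grp i), (Grp i, Pal (2 ^ l))]) (group_list n l)) @
     concat (map gadget_arcs (bad_list n l F))"

lemma set_group_list:
  assumes "l > 0" shows "set (group_list n l) = {..<Suc (n div l)}"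
proof -
  have "i * l \<le> n \<longleftrightarrow> i < Suc (n div l)" for i
    using assms by (simp add: less_Suc_eq_le less_eq_div_iff_mult_less_eq)
  moreover have "i \<le> n" if "i * l \<le> n" for i
    using assms that by (metis Suc_leI One_nat_def le_trans mult_le_mono2 mult.right_neutral)
  moreover have "set (group_list n l) = {i. i \<le> n \<and> i * l \<le> n}"
    by (auto simp: group_list_def less_Suc_eq_le simp del: upt_Suc)
  ultimately show ?thesis by blast
qed

lemma set_triple_list:
  assumes "l > 0" shows "set (triple_list n l) = triples (2 ^ l) (Suc (n div l))"
proof -
  have "set (triple_list n l) = {T. length T = 3 \<and> set T \<subseteq> set (List.product (group_list n l) (rev [0..<2 ^ l]))}"
    unfolding triple_list_def Let_def product_lists_set
    by (auto simp: list_all2_Cons2 numeral_3_eq_3 length_Suc_conv)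
  then show ?thesis
    by (simp add: triples_def set_group_list[OF assms] atLeast0LessThan)
qed

lemma set_bad_list: "l > 0 \<Longrightarrow> set (bad_list n l F) = bad_triples l (Suc (n div l)) F"
  by (auto simp: bad_list_def bad_triples_def set_triple_list)

lemma distinct_bad_list: "distinct (bad_list n l F)"
proof -
  have "distinct (List.product (group_list n l) (rev [0..<2 ^ l]))"
    by (rule distinct_product) (simp_all add: group_list_def del: upt_Suc)
  then show ?thesis
    unfolding bad_list_def triple_list_def Let_def
    by (intro distinct_filter distinct_product_lists) simp
qed

lemma distinct_vertex_list: "distinct (vertex_list n l F)"
proof -
  have "distinct (concat (map (\<lambda>T. [Gad T 0, Gad T 1, Gad T 2, Gad T 3, Gad T 4, Gad T 5]) Ts))" if "distinct Ts" for Ts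
    using that by (induction Ts) auto
  from this[OF distinct_bad_list] show ?thesis
    by (auto simp: vertex_list_def distinct_map inj_on_def group_list_def)
qed

lemma set_vertex_list:
  assumes "l > 0"
  shows "set (vertex_list n l F) = red_verts (2 ^ l) (Suc (n div l)) (bad_triples l (Suc (n div l)) F)"
proof -
  have six: "{..<6} = {0, 1, 2, 3, 4, 5 :: nat}" by auto
  show ?thesis
    by (auto simp: vertex_list_def red_verts_def six set_bad_list[OF assms] set_group_list[OF assms])
qed

lemma set_arc_list:
  assumes l: "l > 0"
  shows "set (arc_list n l F) = red_arcs (2 ^ l) (Suc (n div l)) (bad_triples l (Suc (n div l)) F)"
    (is "_ = red_arcs ?q ?r ?Ts")
proof (intro equalityI subsetI)
  have gad: "e \<in> red_arcs ?q ?r ?Ts" if e: "e \<in> set (gadget_arcs T)" and T: "T \<in> ?Ts" for e T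
  proof -
    \<comment> \<open>With the target index as a variable \<open>k'\<close>, the rules unify with
      the numerals in \<open>gadget_arcs\<close>, and the arithmetic is left as a side
      condition.\<close>
    have cyc': "(Gad T k, Gad T k') \<in> red_arcs ?q ?r ?Ts" if "k < 6" "k' = Suc k mod 6" for k k'
      using cyc[OF T that(1)] that(2) by simp
    have hi_in': "(Pal (Suc (snd (T ! k))), Gad T k') \<in> red_arcs ?q ?r ?Ts" if "k < 3" "k' = k + 3" for k k'
      using hi_in[OF T that(1)] that(2) by simp
    have hi_out': "(Gad T k', Grp (fst (T ! k))) \<in> red_arcs ?q ?r ?Ts" if "k < 3" "k' = k + 3" for k k'
      using hi_out[OF T that(1)] that(2) by simp
    have "set (gadget_arcs T) \<subseteq> red_arcs ?q ?r ?Ts"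
      unfolding gadget_arcs_def list.set insert_subset
      by (intro conjI empty_subsetI cyc' hi_in' hi_out' lo_in[OF T] lo_out[OF T]; simp)
    with e show ?thesis by blast
  qed
  fix e assume "e \<in> set (arc_list n l F)"
  then consider a where "a \<le> ?q" "e = (Hub, Pal a) \<or> e = (Pal a, Hub)"
    | i where "i < ?r" "e = (Hub, Grp i) \<or> e = (Grp i, Hub) \<or> e = (Pal 0, Grp i) \<or> e = (Grp i, Pal ?q)"
    | T where "T \<in> ?Ts" "e \<in> set (gadget_arcs T)"
    unfolding arc_list_def set_append set_concat set_map set_bad_list[OF l] set_group_list[OF l] set_rev set_upt
    by (auto simp: less_Suc_eq_le)
  then show "e \<in> red_arcs ?q ?r ?Ts"
    by cases (use gad in \<open>auto intro: red_arcs.intros\<close>)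
next
  have gad: "set (gadget_arcs T) \<subseteq> set (arc_list n l F)" if "T \<in> ?Ts" for T
    using that by (auto simp: arc_list_def set_bad_list[OF l])
  have k3: "k = 0 \<or> k = 1 \<or> k = 2" if "k < 3" for k :: nat using that by auto
  have k6: "k = 0 \<or> k = 1 \<or> k = 2 \<or> k = 3 \<or> k = 4 \<or> k = 5" if "k < 6" for k :: nat using that by auto
  fix e assume e: "e \<in> red_arcs ?q ?r ?Ts"
  obtain u v where uv: "e = (u, v)" by fastforce
  from e[unfolded uv] have "(u, v) \<in> set (arc_list n l F)"
  proof cases
    case (cyc T k)
    then have "(u, v) \<in> set (gadget_arcs T)" using k6[of k] by (auto simp: gadget_arcs_def)
    then show ?thesis using gad cyc by blast
  next
    case (lo_in T k)
    then have "(u, v) \<in> set (gadget_arcs T)" using k3[of k] by (auto simp: gadget_arcs_def)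
    then show ?thesis using gad lo_in by blast
  next
    case (lo_out T k)
    then have "(u, v) \<in> set (gadget_arcs T)" using k3[of k] by (auto simp: gadget_arcs_def)
    then show ?thesis using gad lo_out by blast
  next
    case (hi_in T k)
    then have "(u, v) \<in> set (gadget_arcs T)" using k3[of k] by (auto simp: gadget_arcs_def)
    then show ?thesis using gad hi_in by blast
  next
    case (hi_out T k)
    then have "(u, v) \<in> set (gadget_arcs T)" using k3[of k] by (auto simp: gadget_arcs_def)
    then show ?thesis using gad hi_out by blast
  qed (auto simp: arc_list_def set_group_list[OF l])
  then show "e \<in> set (arc_list n l F)" unfolding uv .
qed

section \<open>Results of the program on an encoded formula\<close>

lemma mk_filter_enc_list:
  "mk (filter P (dlist (enc_list f xs))) = enc_list f (filter (\<lambda>x. P (f x)) xs)"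
  by (simp add: filter_map o_def)

lemma mk_map_enc_list:
  assumes "\<And>x. x \<in> set xs \<Longrightarrow> f (g x) = h (k x)"
  shows "mk (map f (dlist (enc_list g xs))) = enc_list h (map k xs)"
proof -
  have "map f (dlist (enc_list g xs)) = map h (map k xs)" using assms by simp
  then show ?thesis by (simp only: mk_map_eq)
qed

context
  fixes n l :: nat and F :: cnf and x :: data
  assumes x: "x = enc_cnf n F" and vals: "valuations_data x = enc_valuations l"
begin

lemma left_x: "left x = enc_nat n" by (simp add: x enc_cnf_def)
lemma right_x: "right x = enc_list (enc_list enc_literal) F" by (simp add: x enc_cnf_def)
lemma unary_left_valuations: "unary (left (enc_valuations l)) = enc_nat l"
  by (simp add: left_enc_valuations unary_eq length_hd_valuations)

lemma groups_data: "groups_data x = enc_list enc_nat (group_list n l)"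
  unfolding groups_data_def vals left_x unary_left_valuations down_data_eq group_list_def mk_filter_enc_list
  by (simp add: le_data_iff)

lemma pairs_data: "pairs_data x = enc_list enc_pair (List.product (group_list n l) (rev [0..<2 ^ l]))"
  unfolding pairs_data_def vals groups_data down_data_eq length_enc_valuations product_concat_map
  by (intro bind_data_enc_list mk_map_enc_list) (simp add: enc_pair_def)

lemma cons_data:
  "cons_data (enc_list enc_pair ps) (enc_list (enc_list enc_pair) ls) =
    enc_list (enc_list enc_pair) (concat (map (\<lambda>p. map ((#) p) ls) ps))"
  unfolding cons_data_def by (intro bind_data_enc_list mk_map_enc_list) simp

lemma triples_data:
  "cons_data (pairs_data x) (cons_data (pairs_data x) (cons_data (pairs_data x) (Node Leaf Leaf))) =
    enc_list (enc_list enc_pair) (triple_list n l)"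
proof -
  have "Node Leaf Leaf = enc_list (enc_list enc_pair) [[]]" by simp
  then show ?thesis
    unfolding pairs_data triple_list_def Let_def product_lists.simps by (simp only: cons_data)
qed

lemma refutes_data:
  assumes "set T \<subseteq> I \<times> {..<2 ^ l}"
  shows "refutes_data (enc_valuations l) (enc_list enc_pair T) (enc_literal L) \<longleftrightarrow> refutes l T L"
proof -
  \<comment> \<open>Dropping \<open>a\<close> entries and taking the head is list indexing, valid
    because values in triples stay below \<open>2 ^ l\<close>.\<close>
  have nth: "left (drop_data (enc_nat a) (enc_valuations l)) = enc_list enc_literal (valuations l ! a)" if "a < 2 ^ l" for a
  proof -
    have "drop_data (enc_nat a) (enc_valuations l) = mk (map (enc_list enc_literal) (drop a (valuations l)))"
      by (simp add: drop_data_eq enc_valuations_def drop_map del: mk_map_eq)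
    then show ?thesis using that by (simp add: left_eq_hd length_valuations hd_map hd_drop_conv_nth)
  qed
  have "refutes_data (enc_valuations l) (enc_list enc_pair T) (enc_literal L) \<longleftrightarrow>
    (\<exists>p\<in>set T. \<exists>B\<in>set (dlist (left (drop_data (enc_nat (snd p)) (enc_valuations l)))).
      enc_nat (fst L) = append_data (enc_nat (fst p * l)) (left B) \<and> right B \<noteq> enc_bool (snd L))"
    unfolding refutes_data_def unary_left_valuations by (simp add: enc_pair_def enc_literal_def)
  also have "\<dots> \<longleftrightarrow> (\<exists>p\<in>set T. \<exists>b\<in>set (valuations l ! snd p). fst L = fst p * l + fst b \<and> snd b \<noteq> snd L)"
  proof (rule bex_cong[OF refl])
    fix p assume "p \<in> set T"
    then have p: "snd p < 2 ^ l" using assms by auto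
    show "(\<exists>B\<in>set (dlist (left (drop_data (enc_nat (snd p)) (enc_valuations l)))).
      enc_nat (fst L) = append_data (enc_nat (fst p * l)) (left B) \<and> right B \<noteq> enc_bool (snd L)) \<longleftrightarrow>
      (\<exists>b\<in>set (valuations l ! snd p). fst L = fst p * l + fst b \<and> snd b \<noteq> snd L)"
      by (simp add: nth[OF p] enc_literal_def)
  qed
  also have "\<dots> \<longleftrightarrow> refutes l T L"
    by (simp add: refutes_def split_beta)
  finally show ?thesis .
qed

lemma bad_data:
  assumes l: "l > 0" shows "bad_data x = enc_list (enc_list enc_pair) (bad_list n l F)"
proof -
  have "refutes_data (enc_valuations l) (enc_list enc_pair T) (enc_literal L) \<longleftrightarrow> refutes l T L"
    if "T \<in> set (triple_list n l)" for T L
    using that refutes_data[of T "{..<Suc (n div l)}"] by (simp add: set_triple_list[OF l] triples_def)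
  then show ?thesis
    unfolding bad_data_def Let_def triples_data vals right_x mk_filter_enc_list bad_list_def
    by (intro arg_cong[where f = "enc_list (enc_list enc_pair)"] filter_cong) auto
qed

lemma verts_data:
  assumes l: "l > 0" shows "verts_data x = enc_list enc_vertex (vertex_list n l F)"
proof -
  have "mk (map pal_data (dlist (down_data (Node Leaf (enc_valuations l))))) = enc_list enc_vertex (map Pal (rev [0..<Suc (2 ^ l)]))"
    unfolding down_data_eq dlist.simps list.size(4) length_enc_valuations
    by (simp only: add_0 add_Suc_right Nat.add_0_right, rule mk_map_enc_list) (simp add: enc_vertex_def)
  moreover have "mk (map grp_data (dlist (groups_data x))) = enc_list enc_vertex (map Grp (group_list n l))"
    unfolding groups_data by (rule mk_map_enc_list) (simp add: enc_vertex_def)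
  moreover have "bind_data (\<lambda>T. mk [gad_data 0 T, gad_data 1 T, gad_data 2 T, gad_data 3 T, gad_data 4 T, gad_data 5 T]) (bad_data x) =
    enc_list enc_vertex (concat (map (\<lambda>T. [Gad T 0, Gad T 1, Gad T 2, Gad T 3, Gad T 4, Gad T 5]) (bad_list n l F)))"
    unfolding bad_data[OF l] by (rule bind_data_enc_list) (simp add: enc_vertex_def del: enc_nat.simps add_2_eq_Suc')
  moreover have "Node Leaf Leaf = enc_list enc_vertex [Hub]" by (simp add: enc_vertex_def)
  ultimately show ?thesis
    unfolding verts_data_def vals vertex_list_def by (simp only: append_data_enc_list)
qed

lemma gadget_arcs_data:
  assumes "length T = 3"
  shows "gadget_arcs_data (enc_list enc_pair T) = enc_list enc_arc (gadget_arcs T)"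
proof -
  obtain p p' p'' where T: "T = [p, p', p'']"
    using assms by (auto simp: numeral_3_eq_3 length_Suc_conv)
  have "left (enc_list enc_pair T) = enc_pair p" "left (right (enc_list enc_pair T)) = enc_pair p'"
    "left (right (right (enc_list enc_pair T))) = enc_pair p''" by (simp_all add: T)
  moreover have "T ! 0 = p" "T ! 1 = p'" "T ! 2 = p''" by (simp_all add: T)
  ultimately show ?thesis
    unfolding gadget_arcs_data_def gadget_arcs_def Let_def
    by (simp add: enc_arc_def enc_vertex_def enc_pair_def del: add_2_eq_Suc')
qed

lemma arcs_data:
  assumes l: "l > 0" shows "arcs_data x = enc_list enc_arc (arc_list n l F)"
proof -
  have "bind_data (\<lambda>a. mk [Node Leaf (pal_data a), Node (pal_data a) Leaf]) (down_data (Node Leaf (enc_valuations l))) =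
     enc_list enc_arc (concat (map (\<lambda>a. [(Hub, Pal a), (Pal a, Hub)]) (rev [0..<Suc (2 ^ l)])))"
    unfolding down_data_eq dlist.simps list.size(4) length_enc_valuations
    by (simp only: add_0 add_Suc_right Nat.add_0_right, rule bind_data_enc_list) (simp add: enc_arc_def enc_vertex_def)
  moreover have "bind_data (\<lambda>i. mk [Node Leaf (grp_data i), Node (grp_data i) Leaf, Node (pal_data Leaf) (grp_data i),
          Node (grp_data i) (pal_data (unary (enc_valuations l)))]) (groups_data x) =
    enc_list enc_arc (concat (map (\<lambda>i. [(Hub, Grp i), (Grp i, Hub), (Pal 0, Grp i), (Grp i, Pal (2 ^ l))]) (group_list n l)))"
    unfolding groups_data unary_eq length_enc_valuations
    by (rule bind_data_enc_list) (simp add: enc_arc_def enc_vertex_def)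
  moreover have "bind_data gadget_arcs_data (bad_data x) = enc_list enc_arc (concat (map gadget_arcs (bad_list n l F)))"
    unfolding bad_data[OF l]
    by (rule bind_data_enc_list, rule gadget_arcs_data)
      (auto simp: set_bad_list[OF l] bad_triples_def triples_def)
  ultimately show ?thesis
    unfolding arcs_data_def vals arc_list_def by (simp only: append_data_enc_list)
qed

lemma reduction_eq:
  assumes l: "l > 0"
  shows "reduction x = enc_digraph (length (vertex_list n l F))
    (list_digraph (vertex_list n l F) (set (arc_list n l F)))"
proof -
  let ?vs = "vertex_list n l F" and ?A = "set (arc_list n l F)"
  have "Node (enc_vertex u) (enc_vertex v) \<in> set (dlist (arcs_data x)) \<longleftrightarrow> (u, v) \<in> ?A" for u v
  proof -
    have "Node (enc_vertex u) (enc_vertex v) = enc_arc (u, v)" by (simp add: enc_arc_def)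
    then show ?thesis using inj_enc_arc by (auto simp: arcs_data[OF l] inj_image_mem_iff)
  qed
  then have adj: "(\<exists>a\<in>set (dlist (arcs_data x)). a = Node (enc_vertex u) (enc_vertex v)) \<longleftrightarrow> (u, v) \<in> ?A" for u v
    by blast
  have "reduction x = enc_list (enc_list enc_bool) (map (\<lambda>u. map (\<lambda>v. (u, v) \<in> ?A) ?vs) ?vs)"
    unfolding reduction_def verts_data[OF l] by (intro mk_map_enc_list) (simp only: adj)
  also have "map (\<lambda>u. map (\<lambda>v. (u, v) \<in> ?A) ?vs) ?vs =
     map (\<lambda>i. map (\<lambda>j. (i, j) \<in> parcs (list_digraph ?vs ?A)) [0..<length ?vs]) [0..<length ?vs]"
    by (auto simp: list_digraph_def intro!: nth_equalityI)
  finally show ?thesis by (simp add: enc_digraph_def)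
qed

end

text \<open>Bounds the number of vertices by the output size of the reduction, so its polynomial
  bound also covers the factor \<open>n ^ d\<close> and no vertices need to be counted.\<close>

lemma length_le_size_enc_digraph: "m \<le> size (enc_digraph m G)"
  using length_dlist_le[of "enc_digraph m G"] by (simp add: enc_digraph_def)

text \<open>The summand 9 consists of the hub, one palette vertex beyond \<open>2 ^ l\<close>, one
  group beyond \<open>n div l\<close>, and the six vertices of a component left after deleting the
  core.\<close>

lemma reduction_enc_cnf:
  assumes F: "is_3cnf n F"
  obtains l m G where "reduction (enc_cnf n F) = enc_digraph m G" "m > 0" "pair_digraph G" "pverts G = {..<m}"
    "colorable 2 (with_proj G) \<longleftrightarrow> satisfiable F"
    "underlying_treedepth (with_proj G) \<le> 2 ^ l + n div l + 9"
    "l > 0" "4 ^ (l - 1) \<le> n + length F + 1" "n + length F + 1 < 4 ^ l"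
proof -
  obtain l where l: "valuations_data (enc_cnf n F) = enc_valuations l" "l > 0"
    "4 ^ (l - 1) \<le> n + length F + 1" "n + length F + 1 < 4 ^ l" by (rule valuations_data_enc_cnf)
  let ?vs = "vertex_list n l F" and ?A = "set (arc_list n l F)"
  let ?q = "2 ^ l" and ?r = "Suc (n div l)" let ?Ts = "bad_triples l ?r F"
  have Ts: "?Ts \<subseteq> triples ?q ?r" by (auto simp: bad_triples_def)
  have A: "irrefl ?A" unfolding set_arc_list[OF l(2)] by (rule irrefl_red_arcs)
  have vs: "distinct ?vs" by (rule distinct_vertex_list)
  show thesis
  proof (rule that[of "length ?vs" "list_digraph ?vs ?A" l])
    show "reduction (enc_cnf n F) = enc_digraph (length ?vs) (list_digraph ?vs ?A)"
      using reduction_eq[OF refl l(1,2)] .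
    show "0 < length ?vs" by (simp add: vertex_list_def)
    show "pair_digraph (list_digraph ?vs ?A)" by (rule pair_digraph_list_digraph[OF A])
    show "pverts (list_digraph ?vs ?A) = {..<length ?vs}" by (simp add: list_digraph_def)
    have "colorable 2 (with_proj (list_digraph ?vs ?A)) \<longleftrightarrow>
      (\<exists>c. \<forall>b::bool. acyclic {(u, v) \<in> ?A. c u = b \<and> c v = b})"
      by (rule colorable_list_digraph[OF A _ vs])
        (simp add: set_vertex_list[OF l(2)] set_arc_list[OF l(2)] red_arcs_subset[OF Ts])
    also have "\<dots> \<longleftrightarrow> (\<exists>pos. (\<forall>i<?r. pos i < ?q) \<and> (\<forall>T\<in>?Ts. \<exists>(i, a)\<in>set T. pos i \<noteq> a))"
      unfolding set_arc_list[OF l(2)]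
      using position_of_coloring[OF Ts] coloring_of_position[OF Ts] by blast
    also have "\<dots> \<longleftrightarrow> satisfiable F"
    proof (rule satisfiable_iff_positions[OF F l(2), symmetric])
      \<comment> \<open>The additional group takes up the incomplete last block.\<close>
      show "n < ?r * l" using l(2) by (metis dividend_less_div_times add.commute mult_Suc)
    qed
    finally show "colorable 2 (with_proj (list_digraph ?vs ?A)) \<longleftrightarrow> satisfiable F" .
    have "underlying_treedepth (with_proj (list_digraph ?vs ?A)) \<le> card (red_core ?q ?r) + 6"
    proof (rule underlying_treedepth_list_digraph_le[OF A _ vs])
      show "red_core ?q ?r \<subseteq> set ?vs"
        by (auto simp: set_vertex_list[OF l(2)] red_core_def red_verts_def)
      show "label u = label v" if "(u, v) \<in> ?A" "u \<notin> red_core ?q ?r" "v \<notin> red_core ?q ?r" for u v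
        using label_red_arcs[OF Ts] that unfolding set_arc_list[OF l(2)] by blast
      show "card {v \<in> set ?vs - red_core ?q ?r. label v = L} \<le> 6" for L
        unfolding set_vertex_list[OF l(2)] by (rule card_label_le)
    qed
    with card_red_core_le[of ?q ?r]
    show "underlying_treedepth (with_proj (list_digraph ?vs ?A)) \<le> 2 ^ l + n div l + 9" by linarith
  qed (use l in auto)
qed

section \<open>Running time\<close>

text \<open>The given algorithm expects \<open>Leaf\<close> in every variable except 0, but the
  reduction leaves values in its scratch variables. The base case is a command that changes
  nothing.\<close>

primrec clear :: "nat \<Rightarrow> com" where
  "clear 0 = Assign 0 (Var 0)"
| "clear (Suc k) = Seq (clear k) (Assign (Suc k) (Const Leaf))"

lemma exec_clear: "\<exists>t. \<forall>s. exec (clear k) s t (\<lambda>i. if 1 \<le> i \<and> i \<le> k then Leaf else s i)"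
proof (induction k)
  case 0
  have "exec (clear 0) s 2 (\<lambda>i. if 1 \<le> i \<and> i \<le> 0 then Leaf else s i)" for s
    unfolding clear.simps by (rule exec_AssignI) auto
  then show ?case by blast
next
  case (Suc k)
  then obtain t where t: "\<And>s. exec (clear k) s t (\<lambda>i. if 1 \<le> i \<and> i \<le> k then Leaf else s i)" by blast
  have "exec (Assign (Suc k) (Const Leaf)) (\<lambda>i. if 1 \<le> i \<and> i \<le> k then Leaf else s i) 2
     (\<lambda>i. if 1 \<le> i \<and> i \<le> Suc k then Leaf else s i)" for s
    by (rule exec_AssignI) auto
  from exec.Seq[OF t this] show ?case unfolding clear.simps by blast
qed

lemma ptime_preprocess:
  assumes "ptime f"
  obtains c T where "pbound T"
    "\<And>P x yes B. answers_within P (f x) yes B \<Longrightarrow> answers_within (Seq c P) x yes (T x + B)"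
proof -
  from assms obtain c m T where T: "pbound T" "\<And>m'. m' \<ge> m \<Longrightarrow> realizes c m' T f" by (rule ptimeE) blast
  obtain t0 where t0: "\<And>s. exec (clear m) s t0 (\<lambda>i. if 1 \<le> i \<and> i \<le> m then Leaf else s i)"
    using exec_clear by blast
  show thesis
  proof (rule that)
    show "pbound (\<lambda>x. 2 + T x + t0)" by (intro pbound_intros T)
    fix P x yes and B :: real assume "answers_within P (f x) yes B"
    then obtain t s where P: "exec P ((\<lambda>_. Leaf)(0 := f x)) t s" "real t \<le> B" "s 0 \<noteq> Leaf \<longleftrightarrow> yes"
      unfolding answers_within_def by blast
    let ?s = "(\<lambda>_. Leaf)(0 := x) :: store"
    obtain t1 s1 where e1: "exec c ?s t1 s1" "s1 0 = f (?s 0)" "\<And>i. i \<ge> m \<Longrightarrow> s1 i = ?s i" "t1 \<le> T (?s 0)"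
      by (rule realizesE[OF T(2)[OF order_refl], of ?s]) blast
    have "(\<lambda>i. if 1 \<le> i \<and> i \<le> m then Leaf else s1 i) = (\<lambda>_. Leaf)(0 := f x)"
      using e1(2,3) by (auto simp: fun_eq_iff)
    with t0[of s1] have "exec (clear m) s1 t0 ((\<lambda>_. Leaf)(0 := f x))" by simp
    note e = exec.Seq[OF exec.Seq[OF e1(1) this] P(1)]
    have "real (1 + (1 + t1 + t0) + t) \<le> real (2 + T x + t0) + B" using e1(4) P(2) by simp
    with e P(3) show "answers_within (Seq (Seq c (clear m)) P) x yes (real (2 + T x + t0) + B)"
      unfolding answers_within_def by blast
  qed
qed

text \<open>At most three literals per clause make the unary indices cost about \<open>3 * n\<close>
  per clause, so the encoding is quadratic in the number of variables and clauses.\<close>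

lemma size_enc_cnf_le:
  assumes "is_3cnf n F" shows "size (enc_cnf n F) + 2 \<le> 10 * (n + length F + 1) ^ 2"
proof -
  have clause: "size (enc_list enc_literal C) + 1 \<le> 3 * n + 7" if C: "C \<in> set F" for C
  proof -
    have C3: "length C \<le> 3" "\<And>x b. (x, b) \<in> set C \<Longrightarrow> x < n" using assms C by (auto simp: is_3cnf_def)
    have "size (enc_literal L) + 1 \<le> n + 2" if "L \<in> set C" for L
    proof -
      have "size (enc_bool (snd L)) \<le> 1" by (cases "snd L") auto
      then show ?thesis using C3(2)[of "fst L" "snd L"] that by (simp add: enc_literal_def size_enc_nat)
    qed
    then have "size (enc_list enc_literal C) \<le> (\<Sum>L\<leftarrow>C. n + 2)"
      unfolding size_enc_list by (intro sum_list_mono)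
    also have "\<dots> = length C * (n + 2)" by (simp add: sum_list_triv)
    also have "\<dots> \<le> 3 * (n + 2)" using C3(1) by (rule mult_right_mono) simp
    finally show ?thesis by simp
  qed
  have "size (enc_list (enc_list enc_literal) F) \<le> (\<Sum>C\<leftarrow>F. 3 * n + 7)"
    unfolding size_enc_list[of _ F] by (intro sum_list_mono clause)
  then have "size (enc_list (enc_list enc_literal) F) \<le> length F * (3 * n + 7)" by (simp add: sum_list_triv)
  then have "size (enc_cnf n F) + 2 \<le> n + length F * (3 * n + 7) + 3"
    by (simp add: enc_cnf_def size_enc_nat)
  also have "\<dots> \<le> 10 * (n + length F + 1) ^ 2"
    by (simp add: power2_eq_square algebra_simps)
  finally show ?thesis .
qed

lemma pbound_enc_cnf:
  assumes "pbound T"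
  obtains D K where "\<And>n F. is_3cnf n F \<Longrightarrow> T (enc_cnf n F) \<le> D * (n + length F + 1) ^ K"
proof -
  from assms obtain k where k: "\<And>x. T x \<le> (size x + 2) ^ k" unfolding pbound_def by blast
  have "T (enc_cnf n F) \<le> 10 ^ k * (n + length F + 1) ^ (2 * k)" if "is_3cnf n F" for n F
  proof -
    have "T (enc_cnf n F) \<le> (10 * (n + length F + 1) ^ 2) ^ k"
      using k power_mono[OF size_enc_cnf_le[OF that], of k] by (meson order_trans zero_le)
    then show ?thesis by (simp add: power_mult_distrib flip: power_mult)
  qed
  then show thesis using that by blast
qed

section \<open>The treedepth bound and the exponent of the running time\<close>

text \<open>For \<open>k = 0\<close> the denominator is \<open>ln 1 = 0\<close> and the quotient is \<open>0\<close>, which still bounds \<open>n div l\<close>.\<close>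

definition td_bound :: "nat \<Rightarrow> real" where
  "td_bound k = 2 * sqrt (real k + 1) + 2 * (real k + 1) / ln (real k + 1) + 9"

text \<open>The lower estimate of \<open>N\<close> by a power of 4 bounds the palette by
  \<open>2 * sqrt N\<close>; the upper one gives \<open>ln N < 2 * l\<close>, which bounds the
  number of groups.\<close>

lemma td_bound:
  assumes l: "l > 0" "4 ^ (l - 1) \<le> n + m + 1" "n + m + 1 < 4 ^ l"
  shows "real (2 ^ l + n div l + 9) \<le> td_bound (n + m)"
proof -
  define N where "N = real (n + m) + 1"
  have N: "4 ^ (l - 1) \<le> N" "N < 4 ^ l" "N \<ge> 1"
  proof -
    have "real (4 ^ (l - 1)) \<le> real (n + m + 1)" using l(2) by (rule of_nat_mono)
    moreover have "real (n + m + 1) < real (4 ^ l)" using l(3) by (simp only: of_nat_less_iff)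
    ultimately show "4 ^ (l - 1) \<le> N" "N < 4 ^ l" "N \<ge> 1" by (simp_all add: N_def)
  qed
  have "(2 ^ (l - 1)) ^ 2 \<le> N" using N(1) by (simp add: power2_eq_square flip: power_mult_distrib)
  then have "2 ^ (l - 1) \<le> sqrt N" by (rule real_le_rsqrt)
  moreover have "(2::real) ^ l = 2 * 2 ^ (l - 1)" using l(1) by (cases l) auto
  ultimately have 1: "2 ^ l \<le> 2 * sqrt N" by simp
  have 2: "real (n div l) \<le> 2 * N / ln N"
  proof (cases "N = 1")
    case True
    then have "n = 0" by (simp add: N_def)
    with True show ?thesis by simp
  next
    case False
    \<comment> \<open>The factor 2 in the bound comes from
      \<open>ln 4 = 2 * ln 2 < 2\<close>.\<close>
    with N(3) have pos: "ln N > 0" by simp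
    have "ln N < ln (4 ^ l)" using N by simp
    also have "\<dots> = real l * ln (2 ^ 2)" by (simp add: ln_realpow)
    also have "\<dots> = 2 * real l * ln 2" by (subst ln_realpow) auto
    also have "\<dots> \<le> 2 * real l" using ln_2_less_1 by (simp add: mult_left_le)
    finally have lg: "ln N < 2 * real l" .
    have "real (n div l) \<le> real n / real l" by (rule of_nat_div_le_of_nat)
    also have "\<dots> \<le> N / real l" by (intro divide_right_mono) (auto simp: N_def)
    also have "\<dots> \<le> N / (ln N / 2)"
      using N(3) pos lg l(1) by (intro divide_left_mono) auto
    finally show ?thesis by (simp add: mult.commute)
  qed
  show ?thesis using 1 2 by (simp add: td_bound_def N_def)
qed

text \<open>Only an upper bound on the treedepth is known, and \<open>f\<close> may oscillate, so
  the exponent is the worst case over all possible treedepths. The element 0 keeps it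
  nonnegative.\<close>

definition td_exponent :: "(nat \<Rightarrow> real) \<Rightarrow> nat \<Rightarrow> real" where
  "td_exponent f k = Max (insert 0 ((\<lambda>t. f t * log 2 (real t)) ` {1..nat \<lfloor>td_bound k\<rfloor>}))"

lemma td_exponent_nonneg: "0 \<le> td_exponent f k"
  unfolding td_exponent_def by (rule Max_ge) auto

lemma powr_le_td_exponent:
  assumes "real t \<le> td_bound k"
  shows "real t powr f t \<le> 2 powr td_exponent f k"
proof (cases "t = 0")
  case False
  have "t \<le> nat \<lfloor>td_bound k\<rfloor>" using assms by (simp add: le_nat_floor)
  then have "f t * log 2 (real t) \<le> td_exponent f k"
    using False unfolding td_exponent_def by (intro Max_ge) auto
  moreover have "real t powr f t = 2 powr (f t * log 2 (real t))"
    using False by (simp add: powr_def log_def)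
  ultimately show ?thesis by simp
qed simp

lemma td_exponent_smallo:
  assumes f: "f \<in> o(\<lambda>k. real k)" shows "td_exponent f \<in> o(\<lambda>k. real k)"
proof (rule landau_o.smallI)
  fix \<epsilon> :: real assume \<epsilon>: "\<epsilon> > 0"
  \<comment> \<open>By \<open>ln 2 \<ge> 1 / 2\<close>, passing to base 2 at most doubles the bound
    \<open>3 * real k\<close> obtained below, so this term contributes
    \<open>\<epsilon> / 2 * real k\<close>; the other half is reserved for the constant
    \<open>c\<close>.\<close>
  define \<delta> where "\<delta> = \<epsilon> / 12"
  have ln2: "ln 2 \<ge> (1 / 2 :: real)" using ln_le_minus_one[of "1 / 2 :: real"] by (simp add: ln_div)
  have \<delta>: "\<delta> > 0" using \<epsilon> by (simp add: \<delta>_def)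
  from landau_o.smallD[OF f \<delta>] obtain t0 where t0: "\<And>t. t \<ge> t0 \<Longrightarrow> norm (f t) \<le> \<delta> * norm (real t)"
    unfolding eventually_sequentially by blast
  \<comment> \<open>Smallness of \<open>f\<close> holds only from \<open>t0\<close> on, while small
    treedepths remain possible for large \<open>k\<close>; \<open>c\<close> absorbs these finitely
    many values.\<close>
  define c where "c = Max (insert 0 ((\<lambda>t. \<bar>f t\<bar>) ` {..<t0}))"
  have c0: "c \<ge> 0" unfolding c_def by (rule Max_ge) auto
  have fc: "f t \<le> \<delta> * real t + c" for t
  proof (cases "t < t0")
    case True
    then have "\<bar>f t\<bar> \<le> c" unfolding c_def by (intro Max_ge) auto
    then show ?thesis using \<delta> by (smt (verit) mult_nonneg_nonneg of_nat_0_le_iff)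
  next
    case False
    then show ?thesis using t0[of t] c0 by auto
  qed
  \<comment> \<open>\<open>td_bound k\<close> behaves like \<open>2 * k / ln k\<close> and its
    logarithm like \<open>ln k\<close>, so the product is asymptotically \<open>2 * k\<close>; the
    factor 3 leaves room.\<close>
  have "eventually (\<lambda>k. td_bound k * ln (td_bound k) \<le> 3 * real k) sequentially"
    unfolding td_bound_def by real_asymp
  moreover have "eventually (\<lambda>k. c * log 2 (td_bound k) \<le> \<epsilon> / 2 * real k) sequentially"
  proof -
    have "(\<lambda>k. log 2 (td_bound k)) \<in> o(\<lambda>k. real k)"
      unfolding td_bound_def log_def by real_asymp
    then have "(\<lambda>k. c * log 2 (td_bound k)) \<in> o(\<lambda>k. real k)" by simp
    from landau_o.smallD[OF this, of "\<epsilon> / 2"] \<epsilon> show ?thesis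
      by (auto elim: eventually_mono)
  qed
  moreover have "eventually (\<lambda>k. td_bound k \<ge> 1) sequentially"
    unfolding td_bound_def log_def by real_asymp
  ultimately show "eventually (\<lambda>k. norm (td_exponent f k) \<le> \<epsilon> * norm (real k)) sequentially"
  proof eventually_elim
    case (elim k)
    have "f t * log 2 (real t) \<le> \<epsilon> * real k" if "1 \<le> t" "t \<le> nat \<lfloor>td_bound k\<rfloor>" for t
    proof -
      have t: "real t \<le> td_bound k" using that elim(3) by linarith
      have "f t * log 2 (real t) \<le> (\<delta> * real t + c) * log 2 (real t)"
        using fc that by (intro mult_right_mono) auto
      also have "\<dots> \<le> (\<delta> * td_bound k + c) * log 2 (td_bound k)"
        using t that \<delta> c0 elim(3) by (intro mult_mono add_mono mult_left_mono) auto
      also have "\<dots> = \<delta> * (td_bound k * log 2 (td_bound k)) + c * log 2 (td_bound k)"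
        by (simp add: algebra_simps)
      also have "td_bound k * log 2 (td_bound k) \<le> 2 * (td_bound k * ln (td_bound k))"
        using mult_left_mono[of 1 "2 * ln 2" "ln (td_bound k)"] ln2 elim(3) by (simp add: log_def field_simps)
      also have "\<dots> \<le> 6 * real k" using elim(1) by simp
      finally have "f t * log 2 (real t) \<le> \<delta> * (6 * real k) + c * log 2 (td_bound k)"
        using \<delta> by (simp add: mult_left_mono)
      also have "\<dots> \<le> \<delta> * (6 * real k) + \<epsilon> / 2 * real k"
        using elim(2) by simp
      also have "\<dots> = \<epsilon> * real k" by (simp add: \<delta>_def field_simps)
      finally show ?thesis .
    qed
    then have "td_exponent f k \<le> \<epsilon> * real k"
      unfolding td_exponent_def using \<epsilon> by (intro Max.boundedI) auto
    then show ?case using td_exponent_nonneg[of f k] by simp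
  qed
qed

theorem theorem10:
  assumes "\<exists>P. decides_two_coloring_in_td_to_o_td P"
  shows "\<not> ETH"
proof -
  from assms obtain P f C d where f: "f \<in> o(\<lambda>k. real k)"
    and P: "\<And>n G. n > 0 \<Longrightarrow> pair_digraph G \<Longrightarrow> pverts G = {..<n} \<Longrightarrow>
      answers_within P (enc_digraph n G) (colorable 2 (with_proj G))
        (C * real (underlying_treedepth (with_proj G)) powr f (underlying_treedepth (with_proj G)) * real n ^ d)"
    unfolding decides_two_coloring_in_td_to_o_td_def Let_def by blast
  obtain c T where T: "pbound T"
    "\<And>P x yes B. answers_within P (reduction x) yes B \<Longrightarrow> answers_within (Seq c P) x yes (T x + B)"
    by (rule ptime_preprocess[OF ptime_reduction]) blast
  obtain D1 K1 where DK1: "\<And>n F. is_3cnf n F \<Longrightarrow> T (enc_cnf n F) \<le> D1 * (n + length F + 1) ^ K1"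
    by (rule pbound_enc_cnf[OF T(1)]) blast
  obtain D2 K2 where DK2: "\<And>n F. is_3cnf n F \<Longrightarrow> size (reduction (enc_cnf n F)) ^ d \<le> D2 * (n + length F + 1) ^ K2"
    by (rule pbound_enc_cnf[OF pbound_power[OF ptime_size[OF ptime_reduction]]]) blast
  \<comment> \<open>The sign of \<open>C\<close> is unknown, hence the absolute value; the summand 1
    makes \<open>D\<close> positive, so that \<open>log 2 D\<close> can be undone by
    \<open>powr\<close>.\<close>
  define D where "D = real D1 + \<bar>C\<bar> * real D2 + 1"
  define K where "K = K1 + K2"
  \<comment> \<open>The base 2 logarithm of the total bound: a constant, the polynomial factor from
    reduction and vertex count, and the treedepth factor.\<close>
  define g where "g k = log 2 D + real K * log 2 (real k + 1) + td_exponent f k" for k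
  have D: "D \<ge> 1" by (simp add: D_def)
  have "g \<in> o(\<lambda>k. real k)"
  proof -
    have "(\<lambda>k. log 2 D + real K * log 2 (real k + 1)) \<in> o(\<lambda>k. real k)"
      unfolding log_def by real_asymp
    from sum_in_smallo(1)[OF this td_exponent_smallo[OF f]] show ?thesis unfolding g_def .
  qed
  moreover have "answers_within (Seq c P) (enc_cnf n F) (satisfiable F) (2 powr g (n + length F))"
    if F: "is_3cnf n F" for n F
  proof -
    obtain l m G where G: "reduction (enc_cnf n F) = enc_digraph m G" "m > 0" "pair_digraph G" "pverts G = {..<m}"
      "colorable 2 (with_proj G) \<longleftrightarrow> satisfiable F"
      and td: "underlying_treedepth (with_proj G) \<le> 2 ^ l + n div l + 9"
      and l: "l > 0" "4 ^ (l - 1) \<le> n + length F + 1" "n + length F + 1 < 4 ^ l"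
      by (rule reduction_enc_cnf[OF F])
    define k where "k = n + length F"
    define t where "t = underlying_treedepth (with_proj G)"
    define N where "N = real k + 1"
    define h where "h = 2 powr td_exponent f k"
    have N: "N \<ge> 1" "real (n + length F + 1) = N" by (auto simp: N_def k_def)
    have h: "h \<ge> 1" using td_exponent_nonneg[of f k] by (simp add: h_def ge_one_powr_ge_zero)
    have "real t \<le> td_bound k"
      using td td_bound[OF l] unfolding t_def k_def by linarith
    then have th: "real t powr f t \<le> h" unfolding h_def by (rule powr_le_td_exponent)
    have "m ^ d \<le> size (reduction (enc_cnf n F)) ^ d"
      unfolding G(1) by (intro power_mono length_le_size_enc_digraph) simp
    then have "m ^ d \<le> D2 * (n + length F + 1) ^ K2" using DK2[OF F] by linarith
    then have "real (m ^ d) \<le> real (D2 * (n + length F + 1) ^ K2)" by (rule of_nat_mono)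
    then have md: "real m ^ d \<le> real D2 * N ^ K2" by (simp add: N(2)[symmetric])
    have "real (T (enc_cnf n F)) \<le> real (D1 * (n + length F + 1) ^ K1)" using DK1[OF F] by (rule of_nat_mono)
    then have T1: "real (T (enc_cnf n F)) \<le> real D1 * N ^ K1" by (simp add: N(2)[symmetric])
    have KK: "N ^ K1 \<le> N ^ K" "N ^ K2 \<le> N ^ K" unfolding K_def using N(1) by (auto intro: power_increasing)
    have NK: "N ^ K \<ge> 0" using N(1) by simp
    have "C * real t powr f t * real m ^ d \<le> \<bar>C\<bar> * h * (real D2 * N ^ K2)"
      using th md h by (intro mult_mono) (auto simp: mult_nonneg_nonneg)
    also have "\<dots> \<le> \<bar>C\<bar> * h * (real D2 * N ^ K)"
      using KK h by (intro mult_left_mono) auto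
    finally have 2: "C * real t powr f t * real m ^ d \<le> \<bar>C\<bar> * real D2 * (N ^ K * h)" by (simp add: mult_ac)
    have "real (T (enc_cnf n F)) \<le> real D1 * N ^ K"
      using T1 KK by (meson mult_left_mono of_nat_0_le_iff order_trans)
    also have "\<dots> \<le> real D1 * (N ^ K * h)"
      using mult_left_mono[OF h NK] by (intro mult_left_mono) auto
    finally have "real (T (enc_cnf n F)) + C * real t powr f t * real m ^ d \<le> (real D1 + \<bar>C\<bar> * real D2) * (N ^ K * h)"
      using 2 by (simp add: algebra_simps)
    also have "\<dots> \<le> D * (N ^ K * h)"
      unfolding D_def using NK h by (intro mult_right_mono) auto
    also have "\<dots> = 2 powr g k"
    proof -
      have "2 powr (real K * log 2 N) = N ^ K"
        using N(1) powr_powr[of 2 "log 2 N" "real K"] by (simp add: powr_realpow mult.commute)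
      then show ?thesis using D N(1) by (simp add: g_def powr_add h_def flip: N_def)
    qed
    finally have le: "real (T (enc_cnf n F)) + C * real t powr f t * real m ^ d \<le> 2 powr g k" .
    have "answers_within P (reduction (enc_cnf n F)) (satisfiable F) (C * real t powr f t * real m ^ d)"
      using P[OF G(2-4)] unfolding G(1,5) t_def .
    from T(2)[OF this] le show ?thesis
      unfolding answers_within_def k_def by (meson order_trans)
  qed
  ultimately show ?thesis unfolding ETH_def by blast
qed

end
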